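(* Let $(R,\mathfrak m)$ be a Noetherian local ring (with residue field not necessarily infinite), $M$ a finitely generated $R$-module and $I$ an ideal of $R$ with $\operatorname{grade}(I,M)>0$. Then for all $k\geq \rho^I(M)$ the following hold: (a) $r(I^n,M)=(I^{n+k}M:I^kM)$ for all $n\geq 1$; (b) $\widetilde{I^nM}=(I^{n+k}M:_M I^k)$ for all $n\geq 1$. In particular, when $M=R$, for each $n\geq 1$ we have $\widetilde{I^n}=(I^{n+k}:I^k)$ for all $k\geq \rho^I(R)$.
   Context: $\operatorname{grade}(I,M)>0$ means that $I$ contains a nonzerodivisor on $M$. For submodules $A,B$ of $M$ and an ideal $L$ of $R$: $(A:B)=\{x\in R : xB\subseteq A\}$ and $(A:_M L)=\{m\in M : Lm\subseteq A\}$. For $n\geq 1$: $r(I^n,M)=\bigcup_{k\geq 1}(I^{n+k}M:I^kM)$, $\widetilde{I^nM}=\bigcup_{k\geq 1}(I^{n+k}M:_M I^k)$, and $\widetilde{I^n}=\bigcup_{k\geq 1}(I^{n+k}:I^k)$ (ascending unions). When $\operatorname{grade}(I,M)>0$ one has $\widetilde{I^nM}=I^nM$ for all $n\gg 0$, and $\rho^I(M)$ is defined as $\min\{n\geq 1 : \widetilde{I^iM}=I^iM \text{ for all } i\geq n\}$. *)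

theory Defs
  imports "HOL-Algebra.Algebra"
begin

locale noetherian_local_ring = cring R + noetherian_ring R + maximalideal \<mm> R
  for R (structure) and \<mm> +
  assumes maximal_unique: "maximalideal J R \<Longrightarrow> J = \<mm>"

definition gen_submodule ::
  "('a, 'c) ring_scheme \<Rightarrow> ('a, 'b, 'd) module_scheme \<Rightarrow> 'b set \<Rightarrow> 'b set"
  where "gen_submodule R M S = \<Inter>{N. submodule N R M \<and> S \<subseteq> N}"

definition fin_gen_module :: "('a, 'c) ring_scheme \<Rightarrow> ('a, 'b, 'd) module_scheme \<Rightarrow> bool"
  where "fin_gen_module R M \<longleftrightarrow>
    module R M \<and> (\<exists>S \<subseteq> carrier M. finite S \<and> carrier M = gen_submodule R M S)"

definition ring_module :: "('a, 'c) ring_scheme \<Rightarrow> ('a, 'a) module"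
  where "ring_module R =
    \<lparr>carrier = carrier R, monoid.mult = monoid.mult R, one = one R, ring.zero = ring.zero R, ring.add = ring.add R, smult = monoid.mult R\<rparr>"

lemma ring_module_simps [simp]:
  "carrier (ring_module R) = carrier R"
  "monoid.mult (ring_module R) = monoid.mult R"
  "one (ring_module R) = one R"
  "ring.zero (ring_module R) = ring.zero R"
  "ring.add (ring_module R) = ring.add R"
  "smult (ring_module R) = monoid.mult R"
  by (simp_all add: ring_module_def)

lemma (in cring) ring_module_is_module: "module R (ring_module R)"
proof (rule moduleI)
  show "cring R" by (rule is_cring)
  show "abelian_group (ring_module R)"
    by (rule abelian_groupI) (auto simp: a_ac intro: l_neg)
qed (auto simp: l_distr r_distr m_assoc)

text \<open>
  The product of ideals makes the ideals of \<open>R\<close> a monoid with neutral element \<open>carrier R\<close>,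
  so the zeroth power of an ideal is the whole ring.
\<close>
definition ideal_power :: "('a, 'c) ring_scheme \<Rightarrow> 'a set \<Rightarrow> nat \<Rightarrow> 'a set"
  where "ideal_power R I n = I [^]\<^bsub>ideals_set R\<^esub> n"

lemma ideal_power_0 [simp]: "ideal_power R I 0 = carrier R"
  by (simp add: ideal_power_def ideals_set_def)

lemma ideal_power_Suc [simp]: "ideal_power R I (Suc n) = ideal_power R I n \<cdot>\<^bsub>R\<^esub> I"
  by (simp add: ideal_power_def ideals_set_def)

definition ideal_smult ::
  "('a, 'c) ring_scheme \<Rightarrow> ('a, 'b, 'd) module_scheme \<Rightarrow> 'a set \<Rightarrow> 'b set"
  where "ideal_smult R M L = gen_submodule R M {a \<odot>\<^bsub>M\<^esub> x | a x. a \<in> L \<and> x \<in> carrier M}"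

abbreviation power_smult ::
  "('a, 'c) ring_scheme \<Rightarrow> ('a, 'b, 'd) module_scheme \<Rightarrow> 'a set \<Rightarrow> nat \<Rightarrow> 'b set"
  where "power_smult R M I n \<equiv> ideal_smult R M (ideal_power R I n)"

definition nonzerodivisor_on ::
  "('a, 'c) ring_scheme \<Rightarrow> ('a, 'b, 'd) module_scheme \<Rightarrow> 'a \<Rightarrow> bool"
  where "nonzerodivisor_on R M a \<longleftrightarrow>
    a \<in> carrier R \<and> (\<forall>x \<in> carrier M. a \<odot>\<^bsub>M\<^esub> x = \<zero>\<^bsub>M\<^esub> \<longrightarrow> x = \<zero>\<^bsub>M\<^esub>)"

text \<open>
  No condition \<open>IM \<noteq> M\<close> is imposed: for \<open>M = 0\<close> every element counts as a nonzerodivisor.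
\<close>
definition grade_pos ::
  "('a, 'c) ring_scheme \<Rightarrow> ('a, 'b, 'd) module_scheme \<Rightarrow> 'a set \<Rightarrow> bool"
  where "grade_pos R M I \<longleftrightarrow> (\<exists>a \<in> I. nonzerodivisor_on R M a)"

definition ring_colon ::
  "('a, 'c) ring_scheme \<Rightarrow> ('a, 'b, 'd) module_scheme \<Rightarrow> 'b set \<Rightarrow> 'b set \<Rightarrow> 'a set"
  where "ring_colon R M A B = {a \<in> carrier R. \<forall>x \<in> B. a \<odot>\<^bsub>M\<^esub> x \<in> A}"

definition module_colon :: "('a, 'b, 'd) module_scheme \<Rightarrow> 'b set \<Rightarrow> 'a set \<Rightarrow> 'b set"
  where "module_colon M A L = {x \<in> carrier M. \<forall>a \<in> L. a \<odot>\<^bsub>M\<^esub> x \<in> A}"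

text \<open>
  \<open>rr_ideal\<close> is \<open>r(I\<^sup>n, M)\<close>, a subset of the ring; \<open>rr_module\<close> and \<open>rr_closure\<close> are the
  Ratliff-Rush closures of \<open>I\<^sup>n M\<close> and \<open>I\<^sup>n\<close>.
\<close>
definition rr_ideal ::
  "('a, 'c) ring_scheme \<Rightarrow> ('a, 'b, 'd) module_scheme \<Rightarrow> 'a set \<Rightarrow> nat \<Rightarrow> 'a set"
  where "rr_ideal R M I n =
    (\<Union>k \<in> {1..}. ring_colon R M (power_smult R M I (n + k)) (power_smult R M I k))"

definition rr_module ::
  "('a, 'c) ring_scheme \<Rightarrow> ('a, 'b, 'd) module_scheme \<Rightarrow> 'a set \<Rightarrow> nat \<Rightarrow> 'b set"
  where "rr_module R M I n =
    (\<Union>k \<in> {1..}. module_colon M (power_smult R M I (n + k)) (ideal_power R I k))"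

definition rr_closure :: "('a, 'c) ring_scheme \<Rightarrow> 'a set \<Rightarrow> nat \<Rightarrow> 'a set"
  where "rr_closure R I n =
    (\<Union>k \<in> {1..}. ring_colon R (ring_module R) (ideal_power R I (n + k)) (ideal_power R I k))"

text \<open>
  This minimum is meaningful when \<^const>\<open>grade_pos\<close> holds (and \<open>M\<close> is finitely generated over
  a Noetherian ring), since then the set of admissible \<open>n\<close> is nonempty.
\<close>
definition rr_index ::
  "('a, 'c) ring_scheme \<Rightarrow> ('a, 'b, 'd) module_scheme \<Rightarrow> 'a set \<Rightarrow> nat"
  where "rr_index R M I =
    (LEAST n. 1 \<le> n \<and> (\<forall>i \<ge> n. rr_module R M I i = power_smult R M I i))"

end

theory Submission
  imports Defs
begin

text \<open>
  Write \<open>T\<^sub>n\<close> for the Ratliff-Rush closure of \<open>I\<^sup>nM\<close>. The claim follows quickly once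
  \<open>T\<^sub>i = I\<^sup>iM\<close> is known for all \<open>i\<close> from the index \<open>\<rho>\<close> on: if \<open>I\<^sup>jx \<subseteq> I\<^bsup>n+j\<^esup>M\<close> and
  \<open>a \<in> I\<^sup>k\<close>, then \<open>I\<^sup>j(ax) \<subseteq> I\<^bsup>n+k+j\<^esup>M\<close>, so \<open>ax\<close> lies in \<open>T\<^bsub>n+k\<^esub> = I\<^bsup>n+k\<^esup>M\<close> as soon as
  \<open>k \<ge> \<rho>\<close> (lemma \<open>rr_module_subset_colon\<close>). Hence the witness \<open>j\<close> can be replaced by \<open>k\<close>. The same
  argument, applied to the elements \<open>ay\<close> with \<open>a \<in> r(I\<^sup>n, M)\<close> and \<open>y \<in> I\<^sup>kM\<close>, gives the statement
  about \<open>r(I\<^sup>n, M)\<close> (lemma \<open>rr_ideal_subset_colon\<close>).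

  Since \<open>\<rho>\<close> is a least number, what needs work is that it exists: \<open>T\<^sub>n = I\<^sup>nM\<close> for all large \<open>n\<close>
  (\<open>rr_module_eventually_trivial\<close>). It is enough that \<open>N\<^sub>n = (I\<^bsup>n+1\<^esup>M :\<^sub>M I)\<close> equals \<open>I\<^sup>nM\<close> for
  large \<open>n\<close>, because factors of \<open>I\<close> can then be cancelled from \<open>I\<^sup>jx \<subseteq> I\<^bsup>n+j\<^esup>M\<close> one at a time.
  Let \<open>x \<in> I\<close> be a nonzerodivisor on \<open>M\<close>. Since \<open>xN\<^sub>n \<subseteq> I\<^bsup>n+1\<^esup>M\<close>, the \<open>xN\<^sub>n\<close> form a
  graded submodule of the Rees module \<open>\<Oplus> I\<^sup>nM\<close>, which is Noetherian over the Rees ring.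
  So this graded submodule is finitely generated, which means that \<open>xN\<^bsub>n+1\<^esub> = I xN\<^sub>n\<close> for large
  \<open>n\<close>. Cancelling \<open>x\<close> yields \<open>N\<^bsub>n+1\<^esub> = I N\<^sub>n\<close>, and \<open>I N\<^sub>n \<subseteq> I\<^bsup>n+1\<^esup>M\<close> by the definition of
  \<open>N\<^sub>n\<close>.

  The finite generation (\<open>graded_submodule_eventually_generated\<close>) is proved without constructing
  a Rees or polynomial ring. It is the argument of Hilbert's basis theorem, by induction on
  the number of generators of the ideal, carried out inside the Noetherian module \<open>M\<close>.
\<close>

section \<open>Submodules\<close>

context module
begin

lemma submodule_zero: "submodule H R M \<Longrightarrow> \<zero>\<^bsub>M\<^esub> \<in> H"
  by (metis submodule.axioms(1) subgroup.one_closed monoid.simps(2) monoid_record_simps(2))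

lemma submodule_minus:
  assumes "submodule H R M" "x \<in> H" "y \<in> H"
  shows "x \<ominus>\<^bsub>M\<^esub> y \<in> H"
  using submoduleE[OF assms(1)] assms(2,3) by (simp add: a_minus_def)

lemma submodule_carrier: "submodule H R M \<Longrightarrow> x \<in> H \<Longrightarrow> x \<in> carrier M"
  using submoduleE(1) by blast

lemma submoduleI':
  assumes "H \<subseteq> carrier M" "\<zero>\<^bsub>M\<^esub> \<in> H"
    and "\<And>x y. x \<in> H \<Longrightarrow> y \<in> H \<Longrightarrow> x \<oplus>\<^bsub>M\<^esub> y \<in> H"
    and smult: "\<And>a x. a \<in> carrier R \<Longrightarrow> x \<in> H \<Longrightarrow> a \<odot>\<^bsub>M\<^esub> x \<in> H"
  shows "submodule H R M"
proof (rule submoduleI)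
  fix x assume x: "x \<in> H"
  then have "\<ominus>\<^bsub>M\<^esub> x = (\<ominus>\<^bsub>R\<^esub> \<one>\<^bsub>R\<^esub>) \<odot>\<^bsub>M\<^esub> x"
    using assms(1) smult_l_minus[of "\<one>\<^bsub>R\<^esub>" x] by auto
  then show "\<ominus>\<^bsub>M\<^esub> x \<in> H"
    using smult x by simp
qed (use assms in auto)

lemma smult_left_commute:
  assumes "a \<in> carrier R" "b \<in> carrier R" "x \<in> carrier M"
  shows "a \<odot>\<^bsub>M\<^esub> (b \<odot>\<^bsub>M\<^esub> x) = b \<odot>\<^bsub>M\<^esub> (a \<odot>\<^bsub>M\<^esub> x)"
  by (metis assms smult_assoc1 R.m_comm)

lemma add_diff_cancel_left:
  assumes "x \<in> carrier M" "y \<in> carrier M" "z \<in> carrier M"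
  shows "(x \<oplus>\<^bsub>M\<^esub> y) \<ominus>\<^bsub>M\<^esub> (x \<oplus>\<^bsub>M\<^esub> z) = y \<ominus>\<^bsub>M\<^esub> z"
proof -
  have "(x \<oplus>\<^bsub>M\<^esub> y) \<ominus>\<^bsub>M\<^esub> (x \<oplus>\<^bsub>M\<^esub> z) = (x \<oplus>\<^bsub>M\<^esub> \<ominus>\<^bsub>M\<^esub> x) \<oplus>\<^bsub>M\<^esub> (y \<oplus>\<^bsub>M\<^esub> \<ominus>\<^bsub>M\<^esub> z)"
    using assms unfolding a_minus_def by (simp add: M.minus_add M.a_ac)
  then show ?thesis
    using assms by (simp add: M.r_neg a_minus_def)
qed

lemma submodule_scaled_sum:
  assumes A: "submodule A R M" and B: "submodule B R M" and a: "a \<in> carrier R"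
  shows "submodule {a \<odot>\<^bsub>M\<^esub> x \<oplus>\<^bsub>M\<^esub> y | x y. x \<in> A \<and> y \<in> B} R M" (is "submodule ?S R M")
proof (rule submoduleI')
  show "?S \<subseteq> carrier M"
    using submodule_carrier[OF A] submodule_carrier[OF B] a by auto
  have "\<zero>\<^bsub>M\<^esub> = a \<odot>\<^bsub>M\<^esub> \<zero>\<^bsub>M\<^esub> \<oplus>\<^bsub>M\<^esub> \<zero>\<^bsub>M\<^esub>"
    using a by simp
  then show "\<zero>\<^bsub>M\<^esub> \<in> ?S"
    using submodule_zero[OF A] submodule_zero[OF B] by blast
next
  fix s t assume "s \<in> ?S" "t \<in> ?S"
  then obtain x y x' y' where *: "x \<in> A" "y \<in> B" "x' \<in> A" "y' \<in> B"
    and s: "s = a \<odot>\<^bsub>M\<^esub> x \<oplus>\<^bsub>M\<^esub> y" and t: "t = a \<odot>\<^bsub>M\<^esub> x' \<oplus>\<^bsub>M\<^esub> y'"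
    by blast
  note c = submodule_carrier[OF A *(1)] submodule_carrier[OF B *(2)]
    submodule_carrier[OF A *(3)] submodule_carrier[OF B *(4)]
  have "s \<oplus>\<^bsub>M\<^esub> t = a \<odot>\<^bsub>M\<^esub> (x \<oplus>\<^bsub>M\<^esub> x') \<oplus>\<^bsub>M\<^esub> (y \<oplus>\<^bsub>M\<^esub> y')"
    unfolding s t using c a by (simp add: smult_r_distr M.a_ac)
  then show "s \<oplus>\<^bsub>M\<^esub> t \<in> ?S"
    using submoduleE(5)[OF A *(1,3)] submoduleE(5)[OF B *(2,4)] by blast
next
  fix r s assume r: "r \<in> carrier R" and "s \<in> ?S"
  then obtain x y where *: "x \<in> A" "y \<in> B" and s: "s = a \<odot>\<^bsub>M\<^esub> x \<oplus>\<^bsub>M\<^esub> y"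
    by blast
  note c = submodule_carrier[OF A *(1)] submodule_carrier[OF B *(2)]
  have "r \<odot>\<^bsub>M\<^esub> s = a \<odot>\<^bsub>M\<^esub> (r \<odot>\<^bsub>M\<^esub> x) \<oplus>\<^bsub>M\<^esub> r \<odot>\<^bsub>M\<^esub> y"
    unfolding s using c a r by (simp add: smult_r_distr smult_left_commute)
  then show "r \<odot>\<^bsub>M\<^esub> s \<in> ?S"
    using submoduleE(4)[OF A r *(1)] submoduleE(4)[OF B r *(2)] by blast
qed

lemma submodule_image_smult:
  assumes A: "submodule A R M" and a: "a \<in> carrier R"
  shows "submodule ((\<lambda>x. a \<odot>\<^bsub>M\<^esub> x) ` A) R M"
proof -
  have "submodule {\<zero>\<^bsub>M\<^esub>} R M"
    by (rule submoduleI') auto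
  from submodule_scaled_sum[OF A this a]
  have "submodule {a \<odot>\<^bsub>M\<^esub> x \<oplus>\<^bsub>M\<^esub> y | x y. x \<in> A \<and> y \<in> {\<zero>\<^bsub>M\<^esub>}} R M" .
  also have "{a \<odot>\<^bsub>M\<^esub> x \<oplus>\<^bsub>M\<^esub> y | x y. x \<in> A \<and> y \<in> {\<zero>\<^bsub>M\<^esub>}} = (\<lambda>x. a \<odot>\<^bsub>M\<^esub> x) ` A"
    using submodule_carrier[OF A] a by (force simp: image_def)
  finally show ?thesis .
qed

lemma submodule_colon:
  assumes H: "submodule H R M" and L: "L \<subseteq> carrier R"
  shows "submodule (module_colon M H L) R M"
proof (rule submoduleI')
  show "\<zero>\<^bsub>M\<^esub> \<in> module_colon M H L"
    using L submodule_zero[OF H] by (auto simp: module_colon_def subset_iff)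
next
  fix x y assume "x \<in> module_colon M H L" "y \<in> module_colon M H L"
  then show "x \<oplus>\<^bsub>M\<^esub> y \<in> module_colon M H L"
    using L submoduleE(5)[OF H] by (auto simp: module_colon_def subset_iff smult_r_distr)
next
  fix r x assume r: "r \<in> carrier R" "x \<in> module_colon M H L"
  then show "r \<odot>\<^bsub>M\<^esub> x \<in> module_colon M H L"
    using L submoduleE(4)[OF H] smult_left_commute[of _ r x]
    by (auto simp: module_colon_def subset_iff)
qed (auto simp: module_colon_def)

lemma submodule_Un_chain:
  fixes A :: "nat \<Rightarrow> 'c set"
  assumes sub: "\<And>n. submodule (A n) R M" and mono: "mono A"
  shows "submodule (\<Union>n. A n) R M"
proof (rule submoduleI')
  fix x y assume "x \<in> (\<Union>n. A n)" "y \<in> (\<Union>n. A n)"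
  then obtain m n where "x \<in> A m" "y \<in> A n"
    by blast
  then have "x \<in> A (max m n)" "y \<in> A (max m n)"
    using monoD[OF mono, of m "max m n"] monoD[OF mono, of n "max m n"] by auto
  then show "x \<oplus>\<^bsub>M\<^esub> y \<in> (\<Union>n. A n)"
    using submoduleE(5)[OF sub] by blast
next
  show "(\<Union>n. A n) \<subseteq> carrier M"
    using submoduleE(1)[OF sub] by blast
  show "\<zero>\<^bsub>M\<^esub> \<in> (\<Union>n. A n)"
    using submodule_zero[OF sub] by blast
  show "a \<odot>\<^bsub>M\<^esub> x \<in> (\<Union>n. A n)" if "a \<in> carrier R" "x \<in> (\<Union>n. A n)" for a x
    using that submoduleE(4)[OF sub] by blast
qed

lemma gen_submodule_minimal:
  assumes "submodule N R M" "S \<subseteq> N"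
  shows "gen_submodule R M S \<subseteq> N"
  using assms unfolding gen_submodule_def by blast

lemma gen_submodule_superset: "S \<subseteq> gen_submodule R M S"
  unfolding gen_submodule_def by blast

lemma submodule_gen_submodule:
  assumes "S \<subseteq> carrier M"
  shows "submodule (gen_submodule R M S) R M"
proof (rule submoduleI')
  show "gen_submodule R M S \<subseteq> carrier M"
    using gen_submodule_minimal[OF carrier_is_submodule assms] .
qed (auto simp: gen_submodule_def submodule_zero dest: submoduleE(4,5))

lemma gen_submodule_insert:
  assumes "x \<in> carrier M" "S \<subseteq> carrier M" and y: "y \<in> gen_submodule R M (insert x S)"
  shows "\<exists>r \<in> carrier R. \<exists>s \<in> gen_submodule R M S. y = r \<odot>\<^bsub>M\<^esub> x \<oplus>\<^bsub>M\<^esub> s"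
proof -
  let ?G = "gen_submodule R M S"
  let ?T = "{r \<odot>\<^bsub>M\<^esub> x \<oplus>\<^bsub>M\<^esub> s | r s. r \<in> carrier R \<and> s \<in> ?G}"
  note G = submodule_gen_submodule[OF assms(2)]
  have "submodule ?T R M"
  proof (rule submoduleI')
    show "?T \<subseteq> carrier M"
      using assms(1) submodule_carrier[OF G] by auto
    have "\<zero>\<^bsub>M\<^esub> = \<zero>\<^bsub>R\<^esub> \<odot>\<^bsub>M\<^esub> x \<oplus>\<^bsub>M\<^esub> \<zero>\<^bsub>M\<^esub>"
      using assms(1) by simp
    then show "\<zero>\<^bsub>M\<^esub> \<in> ?T"
      using submodule_zero[OF G] by blast
  next
    fix u v assume "u \<in> ?T" "v \<in> ?T"
    then obtain r s r' s' where *: "r \<in> carrier R" "r' \<in> carrier R" "s \<in> ?G" "s' \<in> ?G"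
      and uv: "u = r \<odot>\<^bsub>M\<^esub> x \<oplus>\<^bsub>M\<^esub> s" "v = r' \<odot>\<^bsub>M\<^esub> x \<oplus>\<^bsub>M\<^esub> s'"
      by blast
    have "u \<oplus>\<^bsub>M\<^esub> v = (r \<oplus>\<^bsub>R\<^esub> r') \<odot>\<^bsub>M\<^esub> x \<oplus>\<^bsub>M\<^esub> (s \<oplus>\<^bsub>M\<^esub> s')"
      unfolding uv using * assms(1) submodule_carrier[OF G]
      by (simp add: smult_l_distr M.a_ac)
    then show "u \<oplus>\<^bsub>M\<^esub> v \<in> ?T"
      using * submoduleE(5)[OF G] by blast
  next
    fix a u assume a: "a \<in> carrier R" and "u \<in> ?T"
    then obtain r s where *: "r \<in> carrier R" "s \<in> ?G" and u: "u = r \<odot>\<^bsub>M\<^esub> x \<oplus>\<^bsub>M\<^esub> s"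
      by blast
    have "a \<odot>\<^bsub>M\<^esub> u = (a \<otimes>\<^bsub>R\<^esub> r) \<odot>\<^bsub>M\<^esub> x \<oplus>\<^bsub>M\<^esub> a \<odot>\<^bsub>M\<^esub> s"
      unfolding u using a * assms(1) submodule_carrier[OF G]
      by (simp add: smult_r_distr smult_assoc1)
    then show "a \<odot>\<^bsub>M\<^esub> u \<in> ?T"
      using a * submoduleE(4)[OF G] by blast
  qed
  moreover have "insert x S \<subseteq> ?T"
  proof -
    have "x = \<one>\<^bsub>R\<^esub> \<odot>\<^bsub>M\<^esub> x \<oplus>\<^bsub>M\<^esub> \<zero>\<^bsub>M\<^esub>"
      using assms(1) by simp
    then have "x \<in> ?T"
      using submodule_zero[OF G] by blast
    moreover have "s \<in> ?T" if "s \<in> S" for s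
    proof -
      have "s = \<zero>\<^bsub>R\<^esub> \<odot>\<^bsub>M\<^esub> x \<oplus>\<^bsub>M\<^esub> s"
        using assms(1,2) that by auto
      then show ?thesis
        using gen_submodule_superset[of S] that by blast
    qed
    ultimately show ?thesis
      by blast
  qed
  ultimately have "y \<in> ?T"
    using gen_submodule_minimal y by blast
  then show ?thesis
    by blast
qed

end

section \<open>Noetherian modules\<close>

locale noetherian_module = module +
  assumes chain_stabilises:
    "(\<And>n. submodule (A n) R M) \<Longrightarrow> mono A \<Longrightarrow> \<exists>N. \<forall>n :: nat. A n \<subseteq> A N"

lemma (in noetherian_ring) ideal_sequence_stabilises:
  assumes "\<And>n :: nat. ideal (L n) R" "mono L"
  shows "\<exists>N. \<forall>n. L n \<subseteq> L N"
proof -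
  have "subset.chain {I. ideal I R} (range L)"
  proof -
    have "L m \<subseteq> L n \<or> L n \<subseteq> L m" for m n
      using monoD[OF assms(2)] nat_le_linear[of m n] by blast
    then show ?thesis
      unfolding subset_chain_def using assms(1) by blast
  qed
  then have "\<Union> (range L) \<in> range L"
    by (intro ideal_chain_is_trivial) auto
  then show ?thesis
    by blast
qed

context module
begin

text \<open>
  For \<open>A \<subseteq> Rx + N\<close> these coefficients of \<open>x\<close> describe the image of \<open>A\<close> in \<open>(Rx + N)/N\<close>, so
  chains of submodules of \<open>Rx + N\<close> are controlled by chains of ideals and chains in \<open>N\<close>.
\<close>
lemma ideal_leading_coefficients:
  assumes x: "x \<in> carrier M" and N: "submodule N R M" and A: "submodule A R M"
  shows "ideal {r \<in> carrier R. \<exists>s \<in> N. r \<odot>\<^bsub>M\<^esub> x \<oplus>\<^bsub>M\<^esub> s \<in> A} R" (is "ideal ?L R")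
proof (rule idealI)
  have zero: "\<zero>\<^bsub>R\<^esub> \<in> ?L"
    using x submodule_zero[OF N] submodule_zero[OF A] by (auto intro!: bexI[of _ "\<zero>\<^bsub>M\<^esub>"])
  have mult: "a \<otimes>\<^bsub>R\<^esub> r \<in> ?L" if a: "a \<in> carrier R" and "r \<in> ?L" for a r
  proof -
    obtain s where r: "r \<in> carrier R" and s: "s \<in> N" "r \<odot>\<^bsub>M\<^esub> x \<oplus>\<^bsub>M\<^esub> s \<in> A"
      using \<open>r \<in> ?L\<close> by blast
    have "(a \<otimes>\<^bsub>R\<^esub> r) \<odot>\<^bsub>M\<^esub> x \<oplus>\<^bsub>M\<^esub> a \<odot>\<^bsub>M\<^esub> s = a \<odot>\<^bsub>M\<^esub> (r \<odot>\<^bsub>M\<^esub> x \<oplus>\<^bsub>M\<^esub> s)"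
      using a r x submodule_carrier[OF N s(1)] by (simp add: smult_assoc1 smult_r_distr)
    then show ?thesis
      using a r submoduleE(4)[OF A a s(2)] submoduleE(4)[OF N a s(1)]
      by (auto intro!: bexI[of _ "a \<odot>\<^bsub>M\<^esub> s"])
  qed
  have add: "r \<oplus>\<^bsub>R\<^esub> r' \<in> ?L" if rr: "r \<in> ?L" "r' \<in> ?L" for r r'
  proof -
    have r: "r \<in> carrier R" "r' \<in> carrier R"
      using that by simp_all
    obtain s s' where s: "s \<in> N" "s' \<in> N"
      and *: "r \<odot>\<^bsub>M\<^esub> x \<oplus>\<^bsub>M\<^esub> s \<in> A" "r' \<odot>\<^bsub>M\<^esub> x \<oplus>\<^bsub>M\<^esub> s' \<in> A"
      using rr by blast
    have "(r \<oplus>\<^bsub>R\<^esub> r') \<odot>\<^bsub>M\<^esub> x \<oplus>\<^bsub>M\<^esub> (s \<oplus>\<^bsub>M\<^esub> s')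
        = (r \<odot>\<^bsub>M\<^esub> x \<oplus>\<^bsub>M\<^esub> s) \<oplus>\<^bsub>M\<^esub> (r' \<odot>\<^bsub>M\<^esub> x \<oplus>\<^bsub>M\<^esub> s')"
      using r x s submodule_carrier[OF N] by (simp add: smult_l_distr M.a_ac)
    then show ?thesis
      using r submoduleE(5)[OF A *] submoduleE(5)[OF N s]
      by (auto intro!: bexI[of _ "s \<oplus>\<^bsub>M\<^esub> s'"])
  qed
  show "ring R" ..
  show "subgroup ?L (add_monoid R)"
  proof (rule R.add.subgroupI)
    show "\<ominus>\<^bsub>R\<^esub> r \<in> ?L" if "r \<in> ?L" for r
      using mult[of "\<ominus>\<^bsub>R\<^esub> \<one>\<^bsub>R\<^esub>" r] that by (auto simp: R.l_minus)
  qed (use zero add in auto)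
  fix r a assume *: "r \<in> ?L" "a \<in> carrier R"
  then show "a \<otimes>\<^bsub>R\<^esub> r \<in> ?L"
    by (rule mult[rotated])
  then show "r \<otimes>\<^bsub>R\<^esub> a \<in> ?L"
    using * R.m_comm by auto
qed

text \<open>
  Induction on the number of generators. If the coefficients of a new generator \<open>x\<close> and the
  intersections with the span \<open>N\<close> of the others are stable from stages \<open>p\<close> and \<open>q\<close> on, then the
  chain is stable from \<open>max p q\<close> on: any \<open>y\<close> in the chain differs from some element of \<open>A p\<close> with
  the same coefficient of \<open>x\<close> by an element of \<open>N\<close>, and that difference already lies in \<open>A q\<close>.
\<close>
lemma gen_submodule_chain_stabilises:
  assumes noeth: "noetherian_ring R"
    and "finite S" "S \<subseteq> carrier M"
    and "\<And>n :: nat. submodule (A n) R M" "mono A" "\<And>n. A n \<subseteq> gen_submodule R M S"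
  shows "\<exists>N. \<forall>n. A n \<subseteq> A N"
  using assms(2-)
proof (induction S arbitrary: A rule: finite_induct)
  case empty
  have "submodule {\<zero>\<^bsub>M\<^esub>} R M"
    by (rule submoduleI') auto
  then have "A n \<subseteq> {\<zero>\<^bsub>M\<^esub>}" for n
    using empty.prems(4) gen_submodule_minimal by blast
  then show ?case
    using submodule_zero[OF empty.prems(2)] by blast
next
  case (insert x S)
  let ?G = "gen_submodule R M S"
  have x: "x \<in> carrier M" and S: "S \<subseteq> carrier M"
    using insert.prems(1) by auto
  note G = submodule_gen_submodule[OF S]
  define L where "L n = {r \<in> carrier R. \<exists>s \<in> ?G. r \<odot>\<^bsub>M\<^esub> x \<oplus>\<^bsub>M\<^esub> s \<in> A n}" for n
  have "ideal (L n) R" for n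
    unfolding L_def by (rule ideal_leading_coefficients[OF x G insert.prems(2)])
  moreover have "mono L"
    unfolding L_def using insert.prems(3) by (fastforce simp: mono_def)
  ultimately obtain p where p: "\<And>n. L n \<subseteq> L p"
    using noetherian_ring.ideal_sequence_stabilises[OF noeth] by blast
  have "submodule (A n \<inter> ?G) R M" for n
    using insert.prems(2) G
    by (intro submoduleI') (auto dest: submoduleE(4,5) submodule_carrier simp: submodule_zero)
  moreover have "mono (\<lambda>n. A n \<inter> ?G)"
    using insert.prems(3) by (fastforce simp: mono_def)
  ultimately obtain q where q: "\<And>n. A n \<inter> ?G \<subseteq> A q \<inter> ?G"
    using insert.IH[of "\<lambda>n. A n \<inter> ?G"] S by auto
  have pq: "A p \<subseteq> A (max p q)" "A q \<subseteq> A (max p q)"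
    using monoD[OF insert.prems(3)] by simp_all
  have "y \<in> A (max p q)" if y: "y \<in> A n" for y n
  proof -
    obtain r s where r: "r \<in> carrier R" and s: "s \<in> ?G" and y_eq: "y = r \<odot>\<^bsub>M\<^esub> x \<oplus>\<^bsub>M\<^esub> s"
      using gen_submodule_insert[OF x S] insert.prems(4) y by blast
    then have "r \<in> L p"
      using y p[of n] by (auto simp: L_def)
    then obtain s' where s': "s' \<in> ?G" and z: "r \<odot>\<^bsub>M\<^esub> x \<oplus>\<^bsub>M\<^esub> s' \<in> A p"
      by (auto simp: L_def)
    let ?z = "r \<odot>\<^bsub>M\<^esub> x \<oplus>\<^bsub>M\<^esub> s'"
    let ?m = "max n p"
    have "y \<in> A ?m" "?z \<in> A ?m"
      using y z monoD[OF insert.prems(3), of n ?m] monoD[OF insert.prems(3), of p ?m] by auto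
    then have "y \<ominus>\<^bsub>M\<^esub> ?z \<in> A ?m"
      by (rule submodule_minus[OF insert.prems(2)])
    moreover have c: "r \<odot>\<^bsub>M\<^esub> x \<in> carrier M" "s \<in> carrier M" "s' \<in> carrier M"
      using r x s s' submodule_carrier[OF G] by auto
    have diff: "y \<ominus>\<^bsub>M\<^esub> ?z = s \<ominus>\<^bsub>M\<^esub> s'"
      unfolding y_eq using c by (simp add: add_diff_cancel_left)
    ultimately have "y \<ominus>\<^bsub>M\<^esub> ?z \<in> A q"
      using q[of ?m] submodule_minus[OF G s s'] by auto
    then have "(y \<ominus>\<^bsub>M\<^esub> ?z) \<oplus>\<^bsub>M\<^esub> ?z \<in> A (max p q)"
      using pq z submoduleE(5)[OF insert.prems(2)] by blast
    moreover have "(y \<ominus>\<^bsub>M\<^esub> ?z) \<oplus>\<^bsub>M\<^esub> ?z = y"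
      using c y_eq by (simp add: a_minus_def M.a_assoc M.l_neg)
    ultimately show ?thesis
      by simp
  qed
  then show ?case
    by blast
qed

lemma noetherian_moduleI:
  assumes "noetherian_ring R" "fin_gen_module R M"
  shows "noetherian_module R M"
proof
  fix A :: "nat \<Rightarrow> 'c set"
  assume A: "\<And>n. submodule (A n) R M" "mono A"
  obtain S where S: "S \<subseteq> carrier M" "finite S" "carrier M = gen_submodule R M S"
    using assms(2) unfolding fin_gen_module_def by blast
  show "\<exists>N. \<forall>n. A n \<subseteq> A N"
  proof (rule gen_submodule_chain_stabilises[OF assms(1) S(2,1) A])
    show "A n \<subseteq> gen_submodule R M S" for n
      using submoduleE(1)[OF A(1)] S(3) by simp
  qed
qed

end

section \<open>Graded submodules of the Rees module\<close>

text \<open>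
  This is \<open>J\<^sup>nM\<close> for the ideal \<open>J\<close> generated by the list. The recursion is the identity
  \<open>(a, J)\<^bsup>n+1\<^esup>M = a (a, J)\<^sup>nM + J\<^bsup>n+1\<^esup>M\<close>, which separates the powers of the head from the
  remaining generators, as an induction on the list requires.
\<close>
fun generated_power :: "('a, 'b, 'd) module_scheme \<Rightarrow> 'a list \<Rightarrow> nat \<Rightarrow> 'b set" where
  "generated_power M as 0 = carrier M"
| "generated_power M [] (Suc n) = {\<zero>\<^bsub>M\<^esub>}"
| "generated_power M (a # as) (Suc n) =
    {a \<odot>\<^bsub>M\<^esub> v \<oplus>\<^bsub>M\<^esub> w | v w. v \<in> generated_power M (a # as) n \<and> w \<in> generated_power M as (Suc n)}"

text \<open>
  The product of the ideal generated by the list with \<open>N\<close>, provided that \<open>N\<close> is a submodule.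
\<close>
fun combinations :: "('a, 'b, 'd) module_scheme \<Rightarrow> 'a list \<Rightarrow> 'b set \<Rightarrow> 'b set" where
  "combinations M [] N = {\<zero>\<^bsub>M\<^esub>}"
| "combinations M (a # as) N =
    {a \<odot>\<^bsub>M\<^esub> v \<oplus>\<^bsub>M\<^esub> w | v w. v \<in> N \<and> w \<in> combinations M as N}"

text \<open>
  The analogue of the polynomials in \<open>a\<close> of degree less than \<open>d\<close> in the \<open>n\<close>-th graded piece:
  with \<open>J\<close> the ideal generated by \<open>as\<close>, it is the sum of all \<open>a\<^sup>jJ\<^bsup>n-j\<^esup>M\<close> with \<open>j < d\<close> and
  \<open>j \<le> n\<close>. The representation of an element as such a sum need not be unique, so leading
  coefficients are available only as a relation.
\<close>
fun degree_below ::
  "('a, 'c) ring_scheme \<Rightarrow> ('a, 'b, 'd) module_scheme \<Rightarrow> 'a \<Rightarrow> 'a list \<Rightarrow> nat \<Rightarrow> nat \<Rightarrow> 'b set" where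
  "degree_below R M a as 0 n = {\<zero>\<^bsub>M\<^esub>}"
| "degree_below R M a as (Suc d) n =
    (if d \<le> n
     then {(a [^]\<^bsub>R\<^esub> d) \<odot>\<^bsub>M\<^esub> w \<oplus>\<^bsub>M\<^esub> u | w u.
             w \<in> generated_power M as (n - d) \<and> u \<in> degree_below R M a as d n}
     else degree_below R M a as d n)"

context module
begin

lemma submodule_singleton_zero: "submodule {\<zero>\<^bsub>M\<^esub>} R M"
  by (rule submoduleI') auto

lemma submodule_generated_power:
  "set as \<subseteq> carrier R \<Longrightarrow> submodule (generated_power M as n) R M"
proof (induction as arbitrary: n)
  case Nil
  show ?case
    by (cases n) (simp_all add: submodule_singleton_zero carrier_is_submodule)
next
  case (Cons a as)
  show ?case
  proof (induction n)
    case (Suc n)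
    then show ?case
      using submodule_scaled_sum[OF Suc Cons.IH] Cons.prems by simp
  qed (simp add: carrier_is_submodule)
qed

lemma smult_generated_power:
  assumes "set as \<subseteq> carrier R" "c \<in> set as" "v \<in> generated_power M as n"
  shows "c \<odot>\<^bsub>M\<^esub> v \<in> generated_power M as (Suc n)"
  using assms
proof (induction as arbitrary: n v)
  case Nil
  then show ?case by simp
next
  case (Cons a as)
  note sub = submodule_generated_power[OF Cons.prems(1)]
  have as: "set as \<subseteq> carrier R" and a: "a \<in> carrier R"
    using Cons.prems(1) by auto
  note sub' = submodule_generated_power[OF as]
  show ?case
  proof (cases "c = a")
    case True
    have "c \<odot>\<^bsub>M\<^esub> v = a \<odot>\<^bsub>M\<^esub> v \<oplus>\<^bsub>M\<^esub> \<zero>\<^bsub>M\<^esub>"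
      using True a submodule_carrier[OF sub Cons.prems(3)] by simp
    then show ?thesis
      using Cons.prems(3) submodule_zero[OF sub'] by auto
  next
    case False
    then have c: "c \<in> set as" "c \<in> carrier R"
      using Cons.prems(1,2) by auto
    show ?thesis
      using Cons.prems(3)
    proof (induction n arbitrary: v)
      case 0
      then have v: "v \<in> carrier M"
        by simp
      have "c \<odot>\<^bsub>M\<^esub> v = a \<odot>\<^bsub>M\<^esub> \<zero>\<^bsub>M\<^esub> \<oplus>\<^bsub>M\<^esub> c \<odot>\<^bsub>M\<^esub> v"
        using a c v by simp
      moreover have "c \<odot>\<^bsub>M\<^esub> v \<in> generated_power M as (Suc 0)"
        using Cons.IH[OF as c(1), of v 0] v by simp
      ultimately show ?case
        by auto
    next
      case (Suc n)
      then obtain u w where u: "u \<in> generated_power M (a # as) n"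
        and w: "w \<in> generated_power M as (Suc n)" and v: "v = a \<odot>\<^bsub>M\<^esub> u \<oplus>\<^bsub>M\<^esub> w"
        by auto
      have "c \<odot>\<^bsub>M\<^esub> v = a \<odot>\<^bsub>M\<^esub> (c \<odot>\<^bsub>M\<^esub> u) \<oplus>\<^bsub>M\<^esub> c \<odot>\<^bsub>M\<^esub> w"
        unfolding v using a c submodule_carrier[OF sub u] submodule_carrier[OF sub' w]
        by (simp add: smult_r_distr smult_left_commute)
      then show ?case
        using Suc.IH[OF u] Cons.IH[OF as c(1) w] generated_power.simps(3)[of M a as "Suc n"]
        by blast
    qed
  qed
qed

lemma submodule_combinations:
  "set as \<subseteq> carrier R \<Longrightarrow> submodule N R M \<Longrightarrow> submodule (combinations M as N) R M"
  by (induction as) (simp_all add: submodule_singleton_zero submodule_scaled_sum)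

lemma combinations_mono: "N \<subseteq> N' \<Longrightarrow> combinations M as N \<subseteq> combinations M as N'"
  by (induction as) auto

lemma combinations_subset:
  assumes "submodule N' R M" "\<And>c v. c \<in> set as \<Longrightarrow> v \<in> N \<Longrightarrow> c \<odot>\<^bsub>M\<^esub> v \<in> N'"
  shows "combinations M as N \<subseteq> N'"
  using assms(2)
proof (induction as)
  case Nil
  then show ?case
    using submodule_zero[OF assms(1)] by simp
next
  case (Cons a as)
  then have "combinations M as N \<subseteq> N'"
    by simp
  then show ?case
    using submoduleE(5)[OF assms(1)] Cons.prems by auto
qed

lemma submodule_degree_below:
  assumes "set (a # as) \<subseteq> carrier R"
  shows "submodule (degree_below R M a as d n) R M"
proof (induction d)
  case (Suc d)
  then show ?case
    using submodule_scaled_sum[OF submodule_generated_power Suc] assms by simp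
qed (simp add: submodule_singleton_zero)

lemma degree_below_Suc_mono:
  assumes "set (a # as) \<subseteq> carrier R"
  shows "degree_below R M a as d n \<subseteq> degree_below R M a as (Suc d) n"
proof (cases "d \<le> n")
  case True
  show ?thesis
  proof
    fix u assume u: "u \<in> degree_below R M a as d n"
    have "u = (a [^]\<^bsub>R\<^esub> d) \<odot>\<^bsub>M\<^esub> \<zero>\<^bsub>M\<^esub> \<oplus>\<^bsub>M\<^esub> u"
      using assms submodule_carrier[OF submodule_degree_below[OF assms] u] by simp
    moreover have "\<zero>\<^bsub>M\<^esub> \<in> generated_power M as (n - d)"
      using assms by (intro submodule_zero submodule_generated_power) simp
    ultimately show "u \<in> degree_below R M a as (Suc d) n"
      using True u by auto
  qed
qed simp

lemma degree_below_mono: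
  assumes "set (a # as) \<subseteq> carrier R" "d \<le> d'"
  shows "degree_below R M a as d n \<subseteq> degree_below R M a as d' n"
  using lift_Suc_mono_le[of "\<lambda>d. degree_below R M a as d n", OF degree_below_Suc_mono[OF assms(1)] assms(2)] .

lemma smult_pow_Suc:
  assumes "a \<in> carrier R" "w \<in> carrier M"
  shows "a \<odot>\<^bsub>M\<^esub> ((a [^]\<^bsub>R\<^esub> (d :: nat)) \<odot>\<^bsub>M\<^esub> w) = (a [^]\<^bsub>R\<^esub> Suc d) \<odot>\<^bsub>M\<^esub> w"
  using assms by (metis R.nat_pow_Suc R.nat_pow_closed R.m_comm smult_assoc1)

lemma smult_head_degree_below:
  assumes as: "set (a # as) \<subseteq> carrier R"
  shows "u \<in> degree_below R M a as d n \<Longrightarrow>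
    a \<odot>\<^bsub>M\<^esub> u \<in> degree_below R M a as (Suc d) (Suc n)"
proof (induction d arbitrary: u)
  case 0
  then show ?case
    using as submodule_zero[OF submodule_degree_below[OF as]] by (simp del: degree_below.simps(2))
next
  case (Suc d)
  show ?case
  proof (cases "d \<le> n")
    case True
    then obtain w v where w: "w \<in> generated_power M as (n - d)"
      and v: "v \<in> degree_below R M a as d n" and u: "u = (a [^]\<^bsub>R\<^esub> d) \<odot>\<^bsub>M\<^esub> w \<oplus>\<^bsub>M\<^esub> v"
      using Suc.prems by auto
    have a: "a \<in> carrier R" and as': "set as \<subseteq> carrier R"
      using as by auto
    have "a \<odot>\<^bsub>M\<^esub> u = (a [^]\<^bsub>R\<^esub> Suc d) \<odot>\<^bsub>M\<^esub> w \<oplus>\<^bsub>M\<^esub> a \<odot>\<^bsub>M\<^esub> v"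
      unfolding u using a submodule_carrier[OF submodule_generated_power[OF as'] w]
        submodule_carrier[OF submodule_degree_below[OF as] v]
      by (simp add: smult_r_distr smult_pow_Suc del: R.nat_pow_Suc)
    moreover have "w \<in> generated_power M as (Suc n - Suc d)"
      using w by simp
    moreover have "Suc d \<le> Suc n"
      using True by simp
    ultimately show ?thesis
      using Suc.IH[OF v] degree_below.simps(2)[of R M a as "Suc d" "Suc n"] by auto
  next
    case False
    then have "u \<in> degree_below R M a as d n"
      using Suc.prems by simp
    then show ?thesis
      using Suc.IH degree_below_Suc_mono[OF as] by blast
  qed
qed

lemma smult_tail_degree_below:
  assumes as: "set (a # as) \<subseteq> carrier R" and c: "c \<in> set as"
  shows "u \<in> degree_below R M a as d n \<Longrightarrow> c \<odot>\<^bsub>M\<^esub> u \<in> degree_below R M a as d (Suc n)"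
proof (induction d arbitrary: u)
  case 0
  then show ?case
    using as c by auto
next
  case (Suc d)
  show ?case
  proof (cases "d \<le> n")
    case True
    then obtain w v where w: "w \<in> generated_power M as (n - d)"
      and v: "v \<in> degree_below R M a as d n" and u: "u = (a [^]\<^bsub>R\<^esub> d) \<odot>\<^bsub>M\<^esub> w \<oplus>\<^bsub>M\<^esub> v"
      using Suc.prems by auto
    have a: "a \<in> carrier R" "c \<in> carrier R" and as': "set as \<subseteq> carrier R"
      using as c by auto
    have "c \<odot>\<^bsub>M\<^esub> u = (a [^]\<^bsub>R\<^esub> d) \<odot>\<^bsub>M\<^esub> (c \<odot>\<^bsub>M\<^esub> w) \<oplus>\<^bsub>M\<^esub> c \<odot>\<^bsub>M\<^esub> v"
      unfolding u using a submodule_carrier[OF submodule_generated_power[OF as'] w]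
        submodule_carrier[OF submodule_degree_below[OF as] v]
      by (simp add: smult_r_distr smult_left_commute)
    moreover have "c \<odot>\<^bsub>M\<^esub> w \<in> generated_power M as (Suc n - d)"
      using smult_generated_power[OF as' c w] True by (simp add: Suc_diff_le)
    ultimately show ?thesis
      using Suc.IH[OF v] True by auto
  next
    case False
    then have "u \<in> degree_below R M a as d n"
      using Suc.prems by simp
    then show ?thesis
      using Suc.IH degree_below_Suc_mono[OF as] by blast
  qed
qed

lemma generated_power_degree_below:
  assumes as: "set (a # as) \<subseteq> carrier R"
  shows "generated_power M (a # as) n \<subseteq> degree_below R M a as (Suc n) n"
proof (induction n)
  case 0
  show ?case
  proof
    fix v assume "v \<in> generated_power M (a # as) 0"
    then have v: "v \<in> carrier M"
      by simp
    then have "\<exists>w. v = \<one>\<^bsub>R\<^esub> \<odot>\<^bsub>M\<^esub> w \<oplus>\<^bsub>M\<^esub> \<zero>\<^bsub>M\<^esub> \<and> w \<in> carrier M"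
      by (intro exI[of _ v]) simp
    then show "v \<in> degree_below R M a as (Suc 0) 0"
      by simp
  qed
next
  case (Suc n)
  note sub = submodule_degree_below[OF as]
  have as': "set as \<subseteq> carrier R"
    using as by simp
  have "w \<in> degree_below R M a as (Suc (Suc n)) (Suc n)" if w: "w \<in> generated_power M as (Suc n)" for w
  proof -
    have "w = (a [^]\<^bsub>R\<^esub> (0 :: nat)) \<odot>\<^bsub>M\<^esub> w \<oplus>\<^bsub>M\<^esub> \<zero>\<^bsub>M\<^esub>"
      using submodule_carrier[OF submodule_generated_power[OF as'] w] by simp
    then have "w \<in> degree_below R M a as (Suc 0) (Suc n)"
      using w by auto
    then show ?thesis
      using degree_below_mono[OF as, of "Suc 0" "Suc (Suc n)"] by blast
  qed
  moreover have "a \<odot>\<^bsub>M\<^esub> v \<in> degree_below R M a as (Suc (Suc n)) (Suc n)"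
    if "v \<in> generated_power M (a # as) n" for v
    using Suc that smult_head_degree_below[OF as] by blast
  ultimately show ?case
    using submoduleE(5)[OF sub] by (auto simp del: degree_below.simps)
qed

end

text \<open>
  The possible coefficients of \<open>a\<^sup>d\<close> in elements of \<open>K\<close> of degree at most \<open>d\<close> in \<open>a\<close>. The second
  index \<open>m\<close> is the degree of the coefficient itself, so the element of \<open>K\<close> has degree \<open>m + d\<close>.
\<close>
definition leading_forms ::
  "('a, 'c) ring_scheme \<Rightarrow> ('a, 'b, 'd) module_scheme \<Rightarrow> 'a \<Rightarrow> 'a list \<Rightarrow> (nat \<Rightarrow> 'b set) \<Rightarrow>
    nat \<Rightarrow> nat \<Rightarrow> 'b set" where
  "leading_forms R M a as K d m =
    {w \<in> generated_power M as m. \<exists>u \<in> degree_below R M a as d (m + d).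
       (a [^]\<^bsub>R\<^esub> d) \<odot>\<^bsub>M\<^esub> w \<oplus>\<^bsub>M\<^esub> u \<in> K (m + d)}"

text \<open>
  A graded submodule of the Rees module \<open>\<Oplus> J\<^sup>nM\<close>, where \<open>J\<close> is generated by \<open>as\<close>.
\<close>
locale graded_submodule = module +
  fixes as :: "'a list" and K :: "nat \<Rightarrow> 'c set"
  assumes gens: "set as \<subseteq> carrier R"
    and sub: "submodule (K n) R M"
    and sub_power: "K n \<subseteq> generated_power M as n"
    and smult_K: "c \<in> set as \<Longrightarrow> v \<in> K n \<Longrightarrow> c \<odot>\<^bsub>M\<^esub> v \<in> K (Suc n)"

locale graded_submodule_Cons = graded_submodule R M "a # as" K
  for R (structure) and M (structure) and a as K
begin

lemma head_carrier: "a \<in> carrier R" and tail_carrier: "set as \<subseteq> carrier R"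
  using gens by auto

abbreviation "L \<equiv> leading_forms R M a as K"
abbreviation "G \<equiv> degree_below R M a as"

lemmas G_sub = submodule_degree_below[OF gens]
lemmas P_sub = submodule_generated_power[OF tail_carrier]

lemma leading_formsE:
  assumes "w \<in> L d m"
  obtains u where "w \<in> carrier M" "w \<in> generated_power M as m" "u \<in> G d (m + d)" "u \<in> carrier M"
    "(a [^] d) \<odot>\<^bsub>M\<^esub> w \<oplus>\<^bsub>M\<^esub> u \<in> K (m + d)"
  using assms submodule_carrier[OF G_sub] submodule_carrier[OF P_sub]
  unfolding leading_forms_def by blast

lemma leading_formsI:
  assumes "w \<in> generated_power M as m" "u \<in> G d (m + d)"
    "(a [^] d) \<odot>\<^bsub>M\<^esub> w \<oplus>\<^bsub>M\<^esub> u \<in> K (m + d)"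
  shows "w \<in> L d m"
  using assms unfolding leading_forms_def by blast

lemma submodule_leading_forms: "submodule (L d m) R M"
proof (rule submoduleI')
  note a = head_carrier
  show "L d m \<subseteq> carrier M"
    using leading_formsE by blast
  show "\<zero>\<^bsub>M\<^esub> \<in> L d m"
    by (rule leading_formsI[of _ _ "\<zero>\<^bsub>M\<^esub>"])
      (use a submodule_zero[OF P_sub] submodule_zero[OF G_sub] submodule_zero[OF sub] in auto)
  show "w \<oplus>\<^bsub>M\<^esub> w' \<in> L d m" if "w \<in> L d m" "w' \<in> L d m" for w w'
  proof -
    obtain u where w: "w \<in> carrier M" "w \<in> generated_power M as m" "u \<in> G d (m + d)"
      "u \<in> carrier M" "(a [^] d) \<odot>\<^bsub>M\<^esub> w \<oplus>\<^bsub>M\<^esub> u \<in> K (m + d)"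
      using leading_formsE[OF \<open>w \<in> L d m\<close>] .
    obtain u' where w': "w' \<in> carrier M" "w' \<in> generated_power M as m" "u' \<in> G d (m + d)"
      "u' \<in> carrier M" "(a [^] d) \<odot>\<^bsub>M\<^esub> w' \<oplus>\<^bsub>M\<^esub> u' \<in> K (m + d)"
      using leading_formsE[OF \<open>w' \<in> L d m\<close>] .
    have "(a [^] d) \<odot>\<^bsub>M\<^esub> (w \<oplus>\<^bsub>M\<^esub> w') \<oplus>\<^bsub>M\<^esub> (u \<oplus>\<^bsub>M\<^esub> u')
        = ((a [^] d) \<odot>\<^bsub>M\<^esub> w \<oplus>\<^bsub>M\<^esub> u) \<oplus>\<^bsub>M\<^esub> ((a [^] d) \<odot>\<^bsub>M\<^esub> w' \<oplus>\<^bsub>M\<^esub> u')"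
      using a w(1,4) w'(1,4) by (simp add: smult_r_distr M.a_ac)
    with submoduleE(5)[OF sub w(5) w'(5)] show ?thesis
      using submoduleE(5)[OF P_sub w(2) w'(2)] submoduleE(5)[OF G_sub w(3) w'(3)]
      by (auto intro: leading_formsI)
  qed
  show "r \<odot>\<^bsub>M\<^esub> w \<in> L d m" if r: "r \<in> carrier R" and "w \<in> L d m" for r w
  proof -
    obtain u where w: "w \<in> carrier M" "w \<in> generated_power M as m" "u \<in> G d (m + d)"
      "u \<in> carrier M" "(a [^] d) \<odot>\<^bsub>M\<^esub> w \<oplus>\<^bsub>M\<^esub> u \<in> K (m + d)"
      using leading_formsE[OF \<open>w \<in> L d m\<close>] .
    have "(a [^] d) \<odot>\<^bsub>M\<^esub> (r \<odot>\<^bsub>M\<^esub> w) \<oplus>\<^bsub>M\<^esub> r \<odot>\<^bsub>M\<^esub> u = r \<odot>\<^bsub>M\<^esub> ((a [^] d) \<odot>\<^bsub>M\<^esub> w \<oplus>\<^bsub>M\<^esub> u)"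
      using a r w(1,4) by (simp add: smult_r_distr smult_left_commute)
    with submoduleE(4)[OF sub r w(5)] show ?thesis
      using submoduleE(4)[OF P_sub r w(2)] submoduleE(4)[OF G_sub r w(3)]
      by (auto intro: leading_formsI)
  qed
qed

lemma leading_forms_subset_power: "L d m \<subseteq> generated_power M as m"
  using leading_formsE by blast

lemma smult_leading_forms:
  assumes c: "c \<in> set as" and "w \<in> L d m"
  shows "c \<odot>\<^bsub>M\<^esub> w \<in> L d (Suc m)"
proof -
  obtain u where w: "w \<in> carrier M" "w \<in> generated_power M as m" "u \<in> G d (m + d)"
    "u \<in> carrier M" "(a [^] d) \<odot>\<^bsub>M\<^esub> w \<oplus>\<^bsub>M\<^esub> u \<in> K (m + d)"
    using leading_formsE[OF assms(2)] .
  have "(a [^] d) \<odot>\<^bsub>M\<^esub> (c \<odot>\<^bsub>M\<^esub> w) \<oplus>\<^bsub>M\<^esub> c \<odot>\<^bsub>M\<^esub> u = c \<odot>\<^bsub>M\<^esub> ((a [^] d) \<odot>\<^bsub>M\<^esub> w \<oplus>\<^bsub>M\<^esub> u)"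
    using head_carrier tail_carrier c w(1,4) by (auto simp: smult_r_distr smult_left_commute)
  also have "\<dots> \<in> K (Suc m + d)"
    using smult_K[OF _ w(5)] c by simp
  finally show ?thesis
    using smult_generated_power[OF tail_carrier c w(2)] smult_tail_degree_below[OF gens c w(3)]
    by (auto intro: leading_formsI)
qed

text \<open>
  Multiplying an element of \<open>K\<close> by \<open>a\<close> raises its degree in \<open>a\<close> and keeps its leading coefficient.
\<close>
lemma leading_forms_Suc_mono: "L d m \<subseteq> L (Suc d) m"
proof
  fix w assume "w \<in> L d m"
  then obtain u where w: "w \<in> carrier M" "w \<in> generated_power M as m" "u \<in> G d (m + d)"
    "u \<in> carrier M" "(a [^] d) \<odot>\<^bsub>M\<^esub> w \<oplus>\<^bsub>M\<^esub> u \<in> K (m + d)"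
    by (rule leading_formsE)
  have "(a [^] Suc d) \<odot>\<^bsub>M\<^esub> w \<oplus>\<^bsub>M\<^esub> a \<odot>\<^bsub>M\<^esub> u = a \<odot>\<^bsub>M\<^esub> ((a [^] d) \<odot>\<^bsub>M\<^esub> w \<oplus>\<^bsub>M\<^esub> u)"
    using head_carrier w(1,4) by (simp add: smult_r_distr smult_pow_Suc del: R.nat_pow_Suc)
  also have "\<dots> \<in> K (m + Suc d)"
    using smult_K[OF _ w(5)] by simp
  finally show "w \<in> L (Suc d) m"
    using w(2) smult_head_degree_below[OF gens w(3)]
    by (intro leading_formsI) (auto simp del: degree_below.simps)
qed

lemma leading_forms_mono: "mono (\<lambda>d. L d m)"
  by (rule incseq_SucI) (rule leading_forms_Suc_mono)

lemma graded_leading_forms: "graded_submodule R M as (L d)"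
  by (intro graded_submodule.intro graded_submodule_axioms.intro module_axioms tail_carrier
      submodule_leading_forms leading_forms_subset_power smult_leading_forms)

lemma graded_Union_leading_forms: "graded_submodule R M as (\<lambda>m. \<Union>d. L d m)"
proof (intro graded_submodule.intro graded_submodule_axioms.intro module_axioms tail_carrier)
  show "submodule (\<Union>d. L d m) R M" for m
    by (rule submodule_Un_chain[OF submodule_leading_forms leading_forms_mono])
  show "(\<Union>d. L d m) \<subseteq> generated_power M as m" for m
    using leading_forms_subset_power by blast
  show "c \<odot>\<^bsub>M\<^esub> w \<in> (\<Union>d. L d (Suc m))" if "c \<in> set as" "w \<in> (\<Union>d. L d m)" for c w m
    using smult_leading_forms that by blast
qed

text \<open>
  A combination of leading forms with coefficients from the tail is the leading form of the
  corresponding combination of elements of \<open>K\<close>. The sublist \<open>bs\<close> is there for the induction only,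
  since \<open>leading_forms\<close> itself depends on \<open>as\<close>.
\<close>
lemma lift_combinations:
  assumes "set bs \<subseteq> set as" "w \<in> combinations M bs (L d m)"
  shows "\<exists>k \<in> combinations M bs (K (m + d)). \<exists>u \<in> G d (Suc (m + d)).
    k = (a [^] d) \<odot>\<^bsub>M\<^esub> w \<oplus>\<^bsub>M\<^esub> u"
  using assms
proof (induction bs arbitrary: w)
  case Nil
  have "\<zero>\<^bsub>M\<^esub> = (a [^] d) \<odot>\<^bsub>M\<^esub> \<zero>\<^bsub>M\<^esub> \<oplus>\<^bsub>M\<^esub> \<zero>\<^bsub>M\<^esub>"
    using head_carrier by simp
  then show ?case
    using Nil submodule_zero[OF G_sub] by auto
next
  case (Cons b bs)
  then obtain v w' where v: "v \<in> L d m" and w': "w' \<in> combinations M bs (L d m)"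
    and w: "w = b \<odot>\<^bsub>M\<^esub> v \<oplus>\<^bsub>M\<^esub> w'"
    by auto
  have b: "b \<in> set as" "b \<in> carrier R" and bs: "set bs \<subseteq> set as" "set bs \<subseteq> carrier R"
    using Cons.prems(1) tail_carrier by auto
  obtain u where u: "v \<in> carrier M" "u \<in> G d (m + d)"
    "u \<in> carrier M" "(a [^] d) \<odot>\<^bsub>M\<^esub> v \<oplus>\<^bsub>M\<^esub> u \<in> K (m + d)"
    using leading_formsE[OF v] .
  obtain k u' where k: "k \<in> combinations M bs (K (m + d))" and u': "u' \<in> G d (Suc (m + d))"
    and k_eq: "k = (a [^] d) \<odot>\<^bsub>M\<^esub> w' \<oplus>\<^bsub>M\<^esub> u'"
    using Cons.IH[OF bs(1) w'] by blast
  have c: "w' \<in> carrier M" "u' \<in> carrier M"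
    using submodule_carrier[OF submodule_combinations[OF bs(2) submodule_leading_forms] w']
      submodule_carrier[OF G_sub u'] .
  have "b \<odot>\<^bsub>M\<^esub> ((a [^] d) \<odot>\<^bsub>M\<^esub> v \<oplus>\<^bsub>M\<^esub> u) \<oplus>\<^bsub>M\<^esub> k
      = (a [^] d) \<odot>\<^bsub>M\<^esub> w \<oplus>\<^bsub>M\<^esub> (b \<odot>\<^bsub>M\<^esub> u \<oplus>\<^bsub>M\<^esub> u')"
    unfolding w k_eq using head_carrier b u(1,3) c
    by (simp add: smult_r_distr smult_left_commute[of b] M.a_ac)
  moreover have "b \<odot>\<^bsub>M\<^esub> u \<oplus>\<^bsub>M\<^esub> u' \<in> G d (Suc (m + d))"
    using submoduleE(5)[OF G_sub smult_tail_degree_below[OF gens b(1) u(2)] u'] .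
  moreover have "b \<odot>\<^bsub>M\<^esub> ((a [^] d) \<odot>\<^bsub>M\<^esub> v \<oplus>\<^bsub>M\<^esub> u) \<oplus>\<^bsub>M\<^esub> k \<in> combinations M (b # bs) (K (m + d))"
    using u(4) k by auto
  ultimately show ?case
    by blast
qed

lemma combinations_subset_K: "combinations M (a # as) (K n) \<subseteq> K (Suc n)"
  by (rule combinations_subset[OF sub smult_K])

text \<open>
  The reduction step: once some generated element \<open>k\<close> has the same leading term \<open>y\<close> as \<open>f\<close>, the
  difference \<open>f - k\<close> has smaller degree in \<open>a\<close> and is generated by the induction hypothesis.
\<close>
lemma cancel_leading_form:
  assumes IH: "K (Suc n) \<inter> G d (Suc n) \<subseteq> combinations M (a # as) (K n)"
    and k: "k \<in> combinations M (a # as) (K n)" "k = y \<oplus>\<^bsub>M\<^esub> u'" "u' \<in> G d (Suc n)"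
    and f: "f \<in> K (Suc n)" "f = y \<oplus>\<^bsub>M\<^esub> u" "u \<in> G d (Suc n)" and y: "y \<in> carrier M"
  shows "f \<in> combinations M (a # as) (K n)"
proof -
  have c: "u \<in> carrier M" "u' \<in> carrier M"
    using submodule_carrier[OF G_sub] f k by blast+
  have "f \<ominus>\<^bsub>M\<^esub> k = u \<ominus>\<^bsub>M\<^esub> u'"
    unfolding f(2) k(2) using c y by (simp add: add_diff_cancel_left)
  moreover have "f \<ominus>\<^bsub>M\<^esub> k \<in> K (Suc n)"
    using submodule_minus[OF sub f(1)] combinations_subset_K k(1) by blast
  ultimately have "f \<ominus>\<^bsub>M\<^esub> k \<in> combinations M (a # as) (K n)"
    using IH submodule_minus[OF G_sub f(3) k(3)] by auto
  then have "(f \<ominus>\<^bsub>M\<^esub> k) \<oplus>\<^bsub>M\<^esub> k \<in> combinations M (a # as) (K n)"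
    using submoduleE(5)[OF submodule_combinations[OF gens sub]] k(1) by blast
  moreover have "(f \<ominus>\<^bsub>M\<^esub> k) \<oplus>\<^bsub>M\<^esub> k = f"
    using c y f(2) k(2) by (simp add: a_minus_def M.a_assoc M.l_neg)
  ultimately show ?thesis
    by simp
qed

text \<open>
  Induction on the degree \<open>d\<close> in \<open>a\<close> of an element of \<open>K (Suc n)\<close>; in each case its leading term is
  matched by a generated element. If \<open>d \<le> D\<close>, the leading coefficient has degree above \<open>E\<close> because
  \<open>n \<ge> D + E\<close>, so it is a combination of leading forms with coefficients from \<open>as\<close>. If \<open>d > D\<close>,
  it already occurs as a leading coefficient in degree \<open>d - 1\<close>, and multiplying by \<open>a\<close> does it.
\<close>
lemma eventually_generated_Cons:
  assumes stable: "\<And>d m. L d m \<subseteq> L D m"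
    and gen: "\<And>d m. d \<le> D \<Longrightarrow> E \<le> m \<Longrightarrow> L d (Suc m) \<subseteq> combinations M as (L d m)"
    and n: "D + E \<le> n"
  shows "K (Suc n) \<subseteq> combinations M (a # as) (K n)"
proof -
  have zero: "\<zero>\<^bsub>M\<^esub> \<in> K n"
    by (rule submodule_zero[OF sub])
  have "K (Suc n) \<inter> G d (Suc n) \<subseteq> combinations M (a # as) (K n)" for d
  proof (induction d)
    case 0
    show ?case
      using submodule_zero[OF submodule_combinations[OF gens sub]] by auto
  next
    case (Suc d)
    show ?case
    proof
      fix f assume f: "f \<in> K (Suc n) \<inter> G (Suc d) (Suc n)"
      show "f \<in> combinations M (a # as) (K n)"
      proof (cases "d \<le> Suc n")
        case False
        then show ?thesis
          using f Suc by auto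
      next
        case True
        then obtain w u where w: "w \<in> generated_power M as (Suc n - d)" and u: "u \<in> G d (Suc n)"
          and f_eq: "f = (a [^] d) \<odot>\<^bsub>M\<^esub> w \<oplus>\<^bsub>M\<^esub> u"
          using f by auto
        have wL: "w \<in> L d (Suc n - d)"
          using w u f f_eq True by (intro leading_formsI) auto
        have y: "(a [^] d) \<odot>\<^bsub>M\<^esub> w \<in> carrier M"
          using head_carrier submodule_carrier[OF P_sub w] by simp
        show ?thesis
        proof (cases "d \<le> D")
          case True
          then have "E \<le> n - d" and eqs: "Suc n - d = Suc (n - d)" "n - d + d = n"
            using n by auto
          then have "w \<in> combinations M as (L d (n - d))"
            using gen[OF True] wL by auto
          from lift_combinations[OF order_refl this] obtain k u'
            where k: "k \<in> combinations M as (K n)" "u' \<in> G d (Suc n)"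
              "k = (a [^] d) \<odot>\<^bsub>M\<^esub> w \<oplus>\<^bsub>M\<^esub> u'"
            unfolding eqs by blast
          have "k = a \<odot>\<^bsub>M\<^esub> \<zero>\<^bsub>M\<^esub> \<oplus>\<^bsub>M\<^esub> k"
            using head_carrier y k(3) submodule_carrier[OF G_sub k(2)] by simp
          then have "k \<in> combinations M (a # as) (K n)"
            using k(1) zero by auto
          then show ?thesis
            using cancel_leading_form[OF Suc _ k(3,2) _ f_eq u y] f by blast
        next
          case False
          then obtain e where d: "d = Suc e" and "D \<le> e"
            by (cases d) auto
          then have "w \<in> L e (Suc n - d)"
            using stable[of d "Suc n - d"] wL monoD[OF leading_forms_mono, of D e "Suc n - d"] by blast
          then obtain u' where u': "u' \<in> G e (Suc n - d + e)" "w \<in> carrier M" "u' \<in> carrier M"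
            "(a [^] e) \<odot>\<^bsub>M\<^esub> w \<oplus>\<^bsub>M\<^esub> u' \<in> K (Suc n - d + e)"
            by (rule leading_formsE)
          have n_eq: "Suc n - d + e = n"
            using \<open>d \<le> Suc n\<close> d by simp
          define k where "k = a \<odot>\<^bsub>M\<^esub> ((a [^] e) \<odot>\<^bsub>M\<^esub> w \<oplus>\<^bsub>M\<^esub> u') \<oplus>\<^bsub>M\<^esub> \<zero>\<^bsub>M\<^esub>"
          have "k \<in> combinations M (a # as) (K n)"
            using u'(4) n_eq submodule_zero[OF submodule_combinations[OF tail_carrier sub]]
            unfolding k_def by auto
          moreover have "k = (a [^] d) \<odot>\<^bsub>M\<^esub> w \<oplus>\<^bsub>M\<^esub> a \<odot>\<^bsub>M\<^esub> u'"
            unfolding k_def d using head_carrier u'(2,3)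
            by (simp add: smult_r_distr smult_pow_Suc del: R.nat_pow_Suc)
          moreover have "a \<odot>\<^bsub>M\<^esub> u' \<in> G d (Suc n)"
            using smult_head_degree_below[OF gens u'(1), unfolded n_eq] unfolding d .
          ultimately show ?thesis
            using cancel_leading_form[OF Suc _ _ _ _ f_eq u y] f by blast
        qed
      qed
    qed
  qed
  then show ?thesis
    using sub_power[of "Suc n"] generated_power_degree_below[OF gens, of "Suc n"] by blast
qed

end

text \<open>
  Induction on the number of generators. For each \<open>d\<close>, the leading forms of degree \<open>d\<close> make a graded
  submodule of the Rees module for the tail, and these increase with \<open>d\<close>. The induction hypothesis
  for their union \<open>U\<close> gives an \<open>N\<close> such that the piece of degree \<open>N\<close> generates all later pieces of \<open>U\<close>. In
  the finitely many degrees up to \<open>N\<close> the chain is stable from a common \<open>D'\<close> on because \<open>M\<close> is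
  Noetherian, and generation propagates this \<open>D'\<close> to all degrees. The induction hypothesis for
  the finitely many \<open>d \<le> D'\<close> provides the bound \<open>E\<close>.
\<close>
theorem (in noetherian_module) graded_submodule_eventually_generated:
  assumes "graded_submodule R M as K"
  shows "\<exists>N. \<forall>n \<ge> N. K (Suc n) \<subseteq> combinations M as (K n)"
  using assms
proof (induction as arbitrary: K)
  case Nil
  interpret graded_submodule R M "[]" K
    by fact
  show ?case
    using sub_power[of "Suc _"] by auto
next
  case (Cons a as)
  interpret graded_submodule_Cons R M a as K
    unfolding graded_submodule_Cons_def by fact
  have "\<exists>D. \<forall>d. L d m \<subseteq> L D m" for m
    by (rule chain_stabilises[OF submodule_leading_forms leading_forms_mono])
  then obtain D where D: "\<And>m d. L d m \<subseteq> L (D m) m"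
    by metis
  obtain N where N: "\<And>m. N \<le> m \<Longrightarrow> (\<Union>d. L d (Suc m)) \<subseteq> combinations M as (\<Union>d. L d m)"
    using Cons.IH[OF graded_Union_leading_forms] by blast
  define D' where "D' = Max (D ` {..N})"
  have small: "L d m \<subseteq> L D' m" if "m \<le> N" for d m
  proof -
    have "D m \<le> D'"
      unfolding D'_def using that by simp
    then show ?thesis
      using D[of d m] monoD[OF leading_forms_mono, of "D m" D' m] by blast
  qed
  have stable: "L d m \<subseteq> L D' m" for d m
  proof (cases "m \<le> N")
    case True
    then show ?thesis
      by (rule small)
  next
    case False
    then have "N \<le> m"
      by simp
    then have "\<forall>d. L d m \<subseteq> L D' m"
    proof (induction m rule: dec_induct)
      case base
      show ?case
        using small by simp
    next
      case (step m)
      have "combinations M as (\<Union>d. L d m) \<subseteq> combinations M as (L D' m)"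
        using step.IH by (intro combinations_mono) blast
      also have "\<dots> \<subseteq> L D' (Suc m)"
        by (rule combinations_subset[OF submodule_leading_forms smult_leading_forms])
      finally show ?case
        using N[of m] step.hyps(1) by blast
    qed
    then show ?thesis
      by blast
  qed
  have "\<exists>e. \<forall>m \<ge> e. L d (Suc m) \<subseteq> combinations M as (L d m)" for d
    by (rule Cons.IH[OF graded_leading_forms])
  then obtain e where e: "\<And>d m. e d \<le> m \<Longrightarrow> L d (Suc m) \<subseteq> combinations M as (L d m)"
    by metis
  define E where "E = Max (e ` {..D'})"
  have "L d (Suc m) \<subseteq> combinations M as (L d m)" if "d \<le> D'" "E \<le> m" for d m
  proof -
    have "e d \<le> E"
      unfolding E_def using that(1) by simp
    then show ?thesis
      using e that(2) by simp
  qed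
  then show ?case
    using eventually_generated_Cons[OF stable] by blast
qed

section \<open>Powers of an ideal acting on a module\<close>

lemma (in cring) ideal_ideal_power:
  assumes "ideal I R"
  shows "ideal (ideal_power R I n) R"
  by (induction n) (simp_all add: oneideal ideal_prod_is_ideal assms)

lemma (in cring) ideal_power_mult_closed:
  assumes I: "ideal I R" and a: "a \<in> ideal_power R I m" and b: "b \<in> ideal_power R I n"
  shows "a \<otimes> b \<in> ideal_power R I (m + n)"
proof -
  interpret ideals: comm_monoid "ideals_set R"
    by (rule ideals_set_is_comm_monoid)
  have "I \<in> carrier (ideals_set R)"
    using I by (simp add: ideals_set_def)
  then have "ideal_power R I (m + n) = ideal_power R I m \<cdot> ideal_power R I n"
    using ideals.nat_pow_mult[of I m n] by (simp add: ideal_power_def ideals_set_def)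
  then show ?thesis
    using ideal_prod.prod[OF a b] by simp
qed

locale module_with_ideal = module +
  fixes I
  assumes ideal: "ideal I R"
begin

abbreviation "Ipow \<equiv> ideal_power R I"
abbreviation "IpowM \<equiv> power_smult R M I"

lemma Ipow_carrier: "a \<in> Ipow n \<Longrightarrow> a \<in> carrier R"
  using ideal.Icarr[OF ideal_ideal_power[OF ideal]] by simp

lemma Ipow_1: "Ipow 1 = I"
  by (simp add: ideal_prod_commute[OF oneideal ideal] ideal_prod_one[OF ideal])

lemma smult_in_IpowM: "a \<in> Ipow n \<Longrightarrow> x \<in> carrier M \<Longrightarrow> a \<odot>\<^bsub>M\<^esub> x \<in> IpowM n"
  unfolding ideal_smult_def by (rule subsetD[OF gen_submodule_superset]) blast

lemma submodule_IpowM: "submodule (IpowM n) R M"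
  unfolding ideal_smult_def by (rule submodule_gen_submodule) (auto dest: Ipow_carrier)

lemma IpowM_subsetI:
  assumes "submodule N R M" "\<And>a x. a \<in> Ipow n \<Longrightarrow> x \<in> carrier M \<Longrightarrow> a \<odot>\<^bsub>M\<^esub> x \<in> N"
  shows "IpowM n \<subseteq> N"
  unfolding ideal_smult_def by (rule gen_submodule_minimal[OF assms(1)]) (use assms(2) in auto)

lemma smult_IpowM:
  assumes a: "a \<in> Ipow k" and x: "x \<in> IpowM n"
  shows "a \<odot>\<^bsub>M\<^esub> x \<in> IpowM (n + k)"
proof -
  note a_car = Ipow_carrier[OF a]
  have "IpowM n \<subseteq> module_colon M (IpowM (n + k)) {a}"
  proof (rule IpowM_subsetI)
    fix b y assume b: "b \<in> Ipow n" and y: "y \<in> carrier M"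
    note b_car = Ipow_carrier[OF b]
    have "a \<odot>\<^bsub>M\<^esub> (b \<odot>\<^bsub>M\<^esub> y) = (b \<otimes>\<^bsub>R\<^esub> a) \<odot>\<^bsub>M\<^esub> y"
      using a_car b_car y by (simp add: smult_assoc1 smult_left_commute)
    also have "\<dots> \<in> IpowM (n + k)"
      using smult_in_IpowM ideal_power_mult_closed[OF ideal b a] y by blast
    finally show "b \<odot>\<^bsub>M\<^esub> y \<in> module_colon M (IpowM (n + k)) {a}"
      using b_car y by (simp add: module_colon_def)
  qed (use submodule_colon[OF submodule_IpowM] a_car in simp)
  then show ?thesis
    using x by (auto simp: module_colon_def)
qed

lemma IpowM_subset_rr_module: "IpowM n \<subseteq> rr_module R M I n"
proof -
  have "IpowM n \<subseteq> module_colon M (IpowM (n + 1)) (Ipow 1)"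
    unfolding module_colon_def using smult_IpowM[of _ 1] submodule_carrier[OF submodule_IpowM]
    by blast
  then show ?thesis
    unfolding rr_module_def by blast
qed

lemma ideal_multiplier:
  assumes A: "submodule A R M" and B: "submodule B R M"
  shows "ideal {c \<in> carrier R. \<forall>v \<in> A. c \<odot>\<^bsub>M\<^esub> v \<in> B} R" (is "ideal ?J R")
proof (rule idealI)
  have mult: "b \<otimes>\<^bsub>R\<^esub> c \<in> ?J" if "b \<in> carrier R" "c \<in> ?J" for b c
    using that submoduleE(4)[OF B] submodule_carrier[OF A] by (simp add: smult_assoc1)
  show "ring R" ..
  show "subgroup ?J (add_monoid R)"
  proof (rule R.add.subgroupI)
    have "\<zero>\<^bsub>R\<^esub> \<in> ?J"
      using submodule_carrier[OF A] submodule_zero[OF B] by simp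
    then show "?J \<noteq> {}"
      by blast
    show "\<ominus>\<^bsub>R\<^esub> c \<in> ?J" if "c \<in> ?J" for c
      using mult[of "\<ominus>\<^bsub>R\<^esub> \<one>\<^bsub>R\<^esub>" c] that by (simp add: R.l_minus)
    show "b \<oplus>\<^bsub>R\<^esub> c \<in> ?J" if "b \<in> ?J" "c \<in> ?J" for b c
      using that submoduleE(5)[OF B] submodule_carrier[OF A] by (simp add: smult_l_distr)
  qed auto
  fix c b assume *: "c \<in> ?J" "b \<in> carrier R"
  then show "b \<otimes>\<^bsub>R\<^esub> c \<in> ?J"
    by (rule mult[rotated])
  then show "c \<otimes>\<^bsub>R\<^esub> b \<in> ?J"
    using * R.m_comm by simp
qed

text \<open>
  Equality holds as well; the inclusion is what places a family of submodules of the \<open>I\<^sup>nM\<close>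
  inside the graded module generated by a list of generators of \<open>I\<close>.
\<close>
lemma IpowM_subset_generated_power:
  assumes as: "set as \<subseteq> carrier R" and I: "I = Idl\<^bsub>R\<^esub> (set as)"
  shows "IpowM n \<subseteq> generated_power M as n"
proof (rule IpowM_subsetI[OF submodule_generated_power[OF as]])
  fix c x assume "c \<in> Ipow n" and x: "x \<in> carrier M"
  then show "c \<odot>\<^bsub>M\<^esub> x \<in> generated_power M as n"
  proof (induction n arbitrary: c)
    case 0
    then show ?case by simp
  next
    case (Suc n)
    note sub = submodule_generated_power[OF as]
    let ?J = "{c \<in> carrier R. \<forall>v \<in> generated_power M as n.
      c \<odot>\<^bsub>M\<^esub> v \<in> generated_power M as (Suc n)}"
    have "set as \<subseteq> ?J"
      using as smult_generated_power[OF as] by blast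
    then have J: "I \<subseteq> ?J"
      unfolding I by (rule genideal_minimal[OF ideal_multiplier[OF sub sub]])
    have "c \<in> Ipow n \<cdot>\<^bsub>R\<^esub> I"
      using Suc.prems(1) by simp
    then have "c \<in> carrier R \<and> c \<odot>\<^bsub>M\<^esub> x \<in> generated_power M as (Suc n)"
    proof (induction c rule: ideal_prod.induct)
      case (prod i j)
      have ij: "i \<in> carrier R" "j \<in> carrier R"
        using prod Ipow_carrier ideal.Icarr[OF ideal] by auto
      then have "(i \<otimes>\<^bsub>R\<^esub> j) \<odot>\<^bsub>M\<^esub> x = j \<odot>\<^bsub>M\<^esub> (i \<odot>\<^bsub>M\<^esub> x)"
        using x by (simp add: smult_assoc1 smult_left_commute)
      then show ?case
        using J prod(2) Suc.IH[OF prod(1) x] ij by auto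
    next
      case (sum s t)
      then show ?case
        using x submoduleE(5)[OF sub] by (simp add: smult_l_distr del: generated_power.simps)
    qed
    then show ?case
      by blast
  qed
qed

section \<open>Ratliff-Rush closures\<close>

abbreviation colon_I :: "nat \<Rightarrow> 'c set" where
  "colon_I n \<equiv> module_colon M (IpowM (Suc n)) I"

lemma submodule_colon_I: "submodule (colon_I n) R M"
  by (rule submodule_colon[OF submodule_IpowM]) (use ideal.Icarr[OF ideal] in blast)

lemma smult_colon_I:
  assumes "c \<in> I" "v \<in> colon_I n"
  shows "c \<odot>\<^bsub>M\<^esub> v \<in> IpowM (Suc n)"
  using assms by (auto simp: module_colon_def)

lemma IpowM_subset_colon_I: "IpowM n \<subseteq> colon_I n"
  using smult_IpowM[of _ 1 _ n] submodule_carrier[OF submodule_IpowM] Ipow_1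
  by (auto simp: module_colon_def simp del: ideal_power_Suc)

lemma IpowM_Suc_subset: "IpowM (Suc n) \<subseteq> IpowM n"
proof (rule IpowM_subsetI[OF submodule_IpowM])
  fix a y assume "a \<in> Ipow (Suc n)" and y: "y \<in> carrier M"
  then have "a \<in> Ipow n"
    using ideal_prod_inter[OF ideal_ideal_power[OF ideal] ideal] by auto
  then show "a \<odot>\<^bsub>M\<^esub> y \<in> IpowM n"
    using y by (rule smult_in_IpowM)
qed

text \<open>
  Multiplication by \<open>x\<close> embeds \<open>\<Oplus> (I\<^bsup>n+1\<^esup>M :\<^sub>M I)\<close> into the Rees module. In large degrees the
  image is generated by products with elements of \<open>I\<close> from one degree lower, and for degree
  \<open>n + 1\<close> such products lie in \<open>x I\<^bsup>n+1\<^esup>M\<close> by the definition of the colon module. As \<open>x\<close> is a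
  nonzerodivisor, it can be cancelled.
\<close>
lemma colon_I_eventually_subset:
  assumes "noetherian_ring R" "noetherian_module R M"
    and x: "x \<in> I" "nonzerodivisor_on R M x"
  shows "\<exists>N. \<forall>n \<ge> N. colon_I n \<subseteq> IpowM n"
proof -
  interpret noetherian_ring R
    by fact
  interpret noetherian_module R M
    by fact
  obtain A where "A \<subseteq> carrier R" "finite A" "I = Idl\<^bsub>R\<^esub> A"
    using finetely_gen[OF ideal] by blast
  then obtain as where as: "set as \<subseteq> carrier R" and I: "I = Idl\<^bsub>R\<^esub> (set as)"
    using finite_list by metis
  have as_I: "set as \<subseteq> I"
    unfolding I by (rule genideal_self[OF as])
  have xR: "x \<in> carrier R"
    using x(2) by (simp add: nonzerodivisor_on_def)
  let ?K = "\<lambda>n. (\<lambda>y. x \<odot>\<^bsub>M\<^esub> y) ` colon_I n"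
  have commute: "c \<odot>\<^bsub>M\<^esub> (x \<odot>\<^bsub>M\<^esub> y) = x \<odot>\<^bsub>M\<^esub> (c \<odot>\<^bsub>M\<^esub> y)" if "c \<in> set as" "y \<in> colon_I n" for c y n
    using that as xR submodule_carrier[OF submodule_colon_I] by (intro smult_left_commute) auto
  have "graded_submodule R M as ?K"
  proof (intro graded_submodule.intro graded_submodule_axioms.intro module_axioms as
      submodule_image_smult[OF submodule_colon_I xR])
    show "?K n \<subseteq> generated_power M as n" for n
      using smult_colon_I[OF x(1)] IpowM_Suc_subset IpowM_subset_generated_power[OF as I, of n]
      by blast
    fix c v n assume c: "c \<in> set as" and "v \<in> ?K n"
    then obtain y where y: "y \<in> colon_I n" and v: "v = x \<odot>\<^bsub>M\<^esub> y"
      by blast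
    have "c \<odot>\<^bsub>M\<^esub> y \<in> colon_I (Suc n)"
      using smult_colon_I[OF _ y] c as_I IpowM_subset_colon_I by blast
    then show "c \<odot>\<^bsub>M\<^esub> v \<in> ?K (Suc n)"
      unfolding v commute[OF c y] by (rule imageI)
  qed
  from graded_submodule_eventually_generated[OF this] obtain N
    where N: "\<And>n. N \<le> n \<Longrightarrow> ?K (Suc n) \<subseteq> combinations M as (?K n)"
    by blast
  have "colon_I (Suc n) \<subseteq> IpowM (Suc n)" if n: "N \<le> n" for n
  proof
    fix y assume y: "y \<in> colon_I (Suc n)"
    have "combinations M as (?K n) \<subseteq> (\<lambda>z. x \<odot>\<^bsub>M\<^esub> z) ` IpowM (Suc n)"
    proof (rule combinations_subset[OF submodule_image_smult[OF submodule_IpowM xR]])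
      fix c v assume c: "c \<in> set as" and "v \<in> ?K n"
      then obtain z where z: "z \<in> colon_I n" and v: "v = x \<odot>\<^bsub>M\<^esub> z"
        by blast
      show "c \<odot>\<^bsub>M\<^esub> v \<in> (\<lambda>z. x \<odot>\<^bsub>M\<^esub> z) ` IpowM (Suc n)"
        unfolding v commute[OF c z] using smult_colon_I[OF _ z] c as_I by blast
    qed
    moreover have "x \<odot>\<^bsub>M\<^esub> y \<in> combinations M as (?K n)"
      using N[OF n] y by blast
    ultimately obtain z where z: "z \<in> IpowM (Suc n)" and eq: "x \<odot>\<^bsub>M\<^esub> y = x \<odot>\<^bsub>M\<^esub> z"
      by blast
    have car: "y \<in> carrier M" "z \<in> carrier M"
      using submodule_carrier[OF submodule_colon_I y] submodule_carrier[OF submodule_IpowM z] .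
    have "x \<odot>\<^bsub>M\<^esub> (y \<ominus>\<^bsub>M\<^esub> z) = \<zero>\<^bsub>M\<^esub>"
      using eq car xR by (simp add: a_minus_def smult_r_distr smult_r_minus M.r_neg)
    then have "y \<ominus>\<^bsub>M\<^esub> z = \<zero>\<^bsub>M\<^esub>"
      using x(2) car by (simp add: nonzerodivisor_on_def)
    moreover have "(y \<ominus>\<^bsub>M\<^esub> z) \<oplus>\<^bsub>M\<^esub> z = y"
      using car by (simp add: a_minus_def M.a_assoc M.l_neg)
    ultimately show "y \<in> IpowM (Suc n)"
      using car z by (simp del: ideal_power_Suc)
  qed
  then have "colon_I n \<subseteq> IpowM n" if "Suc N \<le> n" for n
    using that by (cases n) (simp_all del: ideal_power_Suc)
  then show ?thesis
    by blast
qed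

text \<open>
  If \<open>I\<^bsup>k+1\<^esup>y \<subseteq> I\<^bsup>n+k+1\<^esup>M\<close>, then every element of \<open>I\<^sup>ky\<close> lies in \<open>(I\<^bsup>n+k+1\<^esup>M :\<^sub>M I)\<close>, hence in
  \<open>I\<^bsup>n+k\<^esup>M\<close>; so one factor of \<open>I\<close> is removed at a time.
\<close>
lemma colon_Ipow_subset:
  assumes N: "\<And>n. N \<le> n \<Longrightarrow> colon_I n \<subseteq> IpowM n" and n: "N \<le> n"
  shows "module_colon M (IpowM (n + k)) (Ipow k) \<subseteq> IpowM n"
proof (induction k)
  case 0
  show ?case
    by (auto simp: module_colon_def)
      (metis R.one_closed smult_one)
next
  case (Suc k)
  have "module_colon M (IpowM (n + Suc k)) (Ipow (Suc k)) \<subseteq> module_colon M (IpowM (n + k)) (Ipow k)"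
  proof
    fix y assume y: "y \<in> module_colon M (IpowM (n + Suc k)) (Ipow (Suc k))"
    then have yM: "y \<in> carrier M"
      by (simp add: module_colon_def)
    have "b \<odot>\<^bsub>M\<^esub> y \<in> IpowM (n + k)" if b: "b \<in> Ipow k" for b
    proof -
      have "c \<odot>\<^bsub>M\<^esub> (b \<odot>\<^bsub>M\<^esub> y) \<in> IpowM (Suc (n + k))" if c: "c \<in> I" for c
      proof -
        have "b \<otimes>\<^bsub>R\<^esub> c \<in> Ipow (Suc k)"
          using ideal_prod.prod[OF b c] by simp
        moreover have "c \<odot>\<^bsub>M\<^esub> (b \<odot>\<^bsub>M\<^esub> y) = (b \<otimes>\<^bsub>R\<^esub> c) \<odot>\<^bsub>M\<^esub> y"
          using Ipow_carrier[OF b] ideal.Icarr[OF ideal c] yM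
          by (simp add: smult_assoc1 smult_left_commute)
        ultimately show ?thesis
          using y by (simp add: module_colon_def del: ideal_power_Suc)
      qed
      then have "b \<odot>\<^bsub>M\<^esub> y \<in> colon_I (n + k)"
        using Ipow_carrier[OF b] yM by (simp add: module_colon_def)
      then show ?thesis
        using N[of "n + k"] n by auto
    qed
    then show "y \<in> module_colon M (IpowM (n + k)) (Ipow k)"
      using yM by (simp add: module_colon_def)
  qed
  then show ?case
    using Suc by blast
qed

theorem rr_module_eventually_trivial:
  assumes "noetherian_ring R" "fin_gen_module R M" "grade_pos R M I"
  shows "\<exists>N. \<forall>n \<ge> N. rr_module R M I n = IpowM n"
proof -
  obtain x where x: "x \<in> I" "nonzerodivisor_on R M x"
    using assms(3) unfolding grade_pos_def by blast
  obtain N where "\<And>n. N \<le> n \<Longrightarrow> colon_I n \<subseteq> IpowM n"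
    using colon_I_eventually_subset[OF assms(1) noetherian_moduleI[OF assms(1,2)] x] by blast
  then have "rr_module R M I n \<subseteq> IpowM n" if "N \<le> n" for n
    using colon_Ipow_subset[OF _ that] unfolding rr_module_def by blast
  then show ?thesis
    using IpowM_subset_rr_module by blast
qed

text \<open>
  The least number in the definition of \<open>rr_index\<close> is attained because the Ratliff-Rush
  closures are eventually trivial.
\<close>
lemma rr_index_props:
  assumes "noetherian_ring R" "fin_gen_module R M" "grade_pos R M I"
  shows "1 \<le> rr_index R M I"
    and "\<And>n. rr_index R M I \<le> n \<Longrightarrow> rr_module R M I n = IpowM n"
proof -
  let ?P = "\<lambda>n. 1 \<le> n \<and> (\<forall>i \<ge> n. rr_module R M I i = IpowM i)"
  obtain N where "\<forall>n \<ge> N. rr_module R M I n = IpowM n"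
    using rr_module_eventually_trivial[OF assms] by blast
  then have "?P (max 1 N)"
    by simp
  then have "?P (rr_index R M I)"
    unfolding rr_index_def by (rule LeastI)
  then show "1 \<le> rr_index R M I" "\<And>n. rr_index R M I \<le> n \<Longrightarrow> rr_module R M I n = IpowM n"
    by blast+
qed

text \<open>
  If \<open>j\<close> witnesses that \<open>x\<close> is in the closure of \<open>I\<^sup>nM\<close>, then the same \<open>j\<close> witnesses that \<open>ax\<close> is in
  the closure of \<open>I\<^bsup>n+k\<^esup>M\<close>, for every \<open>a \<in> I\<^sup>k\<close>.
\<close>
lemma rr_module_subset_colon:
  assumes "rr_module R M I (n + k) = IpowM (n + k)"
  shows "rr_module R M I n \<subseteq> module_colon M (IpowM (n + k)) (Ipow k)"
proof
  fix x assume "x \<in> rr_module R M I n"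
  then obtain j where j: "1 \<le> j" and xM: "x \<in> carrier M"
    and x: "\<And>b. b \<in> Ipow j \<Longrightarrow> b \<odot>\<^bsub>M\<^esub> x \<in> IpowM (n + j)"
    unfolding rr_module_def module_colon_def by auto
  have "a \<odot>\<^bsub>M\<^esub> x \<in> IpowM (n + k)" if a: "a \<in> Ipow k" for a
  proof -
    have "b \<odot>\<^bsub>M\<^esub> (a \<odot>\<^bsub>M\<^esub> x) \<in> IpowM (n + k + j)" if b: "b \<in> Ipow j" for b
      using smult_IpowM[OF a x[OF b]] smult_left_commute[OF Ipow_carrier[OF a] Ipow_carrier[OF b] xM]
      by (simp add: ac_simps)
    then have "a \<odot>\<^bsub>M\<^esub> x \<in> rr_module R M I (n + k)"
      using j xM Ipow_carrier[OF a] unfolding rr_module_def module_colon_def by auto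
    then show ?thesis
      using assms by simp
  qed
  then show "x \<in> module_colon M (IpowM (n + k)) (Ipow k)"
    using xM by (simp add: module_colon_def)
qed

text \<open>
  It suffices to test generators \<open>cz\<close> of \<open>I\<^sup>kM\<close>, with \<open>c \<in> I\<^sup>k\<close>. For \<open>b \<in> I\<^sup>j\<close> the product \<open>b (a (c z))\<close>
  equals \<open>c (a (b z))\<close>, where \<open>a (b z) \<in> I\<^bsup>n+j\<^esup>M\<close> by the choice of \<open>j\<close>, so \<open>a (c z)\<close> is in the
  Ratliff-Rush closure of \<open>I\<^bsup>n+k\<^esup>M\<close>.
\<close>
lemma rr_ideal_subset_colon:
  assumes "rr_module R M I (n + k) = IpowM (n + k)"
  shows "rr_ideal R M I n \<subseteq> ring_colon R M (IpowM (n + k)) (IpowM k)"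
proof
  fix a assume "a \<in> rr_ideal R M I n"
  then obtain j where j: "1 \<le> j" and aR: "a \<in> carrier R"
    and a: "\<And>y. y \<in> IpowM j \<Longrightarrow> a \<odot>\<^bsub>M\<^esub> y \<in> IpowM (n + j)"
    unfolding rr_ideal_def ring_colon_def by auto
  have "IpowM k \<subseteq> module_colon M (IpowM (n + k)) {a}"
  proof (rule IpowM_subsetI)
    fix c z assume c: "c \<in> Ipow k" and z: "z \<in> carrier M"
    note cR = Ipow_carrier[OF c]
    have "b \<odot>\<^bsub>M\<^esub> (a \<odot>\<^bsub>M\<^esub> (c \<odot>\<^bsub>M\<^esub> z)) \<in> IpowM (n + k + j)" if b: "b \<in> Ipow j" for b
    proof -
      note bR = Ipow_carrier[OF b]
      have "b \<odot>\<^bsub>M\<^esub> (a \<odot>\<^bsub>M\<^esub> (c \<odot>\<^bsub>M\<^esub> z)) = c \<odot>\<^bsub>M\<^esub> (a \<odot>\<^bsub>M\<^esub> (b \<odot>\<^bsub>M\<^esub> z))"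
        using aR bR cR z by (metis smult_closed smult_left_commute)
      then show ?thesis
        using smult_IpowM[OF c a[OF smult_in_IpowM[OF b z]]] by (simp add: ac_simps)
    qed
    then have "a \<odot>\<^bsub>M\<^esub> (c \<odot>\<^bsub>M\<^esub> z) \<in> rr_module R M I (n + k)"
      using j aR cR z unfolding rr_module_def module_colon_def by auto
    then show "c \<odot>\<^bsub>M\<^esub> z \<in> module_colon M (IpowM (n + k)) {a}"
      using assms cR z by (simp add: module_colon_def)
  qed (use submodule_colon[OF submodule_IpowM] aR in simp)
  then show "a \<in> ring_colon R M (IpowM (n + k)) (IpowM k)"
    using aR by (auto simp: module_colon_def ring_colon_def)
qed

lemma rr_eq_colon:
  assumes "noetherian_ring R" "fin_gen_module R M" "grade_pos R M I" and k: "rr_index R M I \<le> k"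
  shows "rr_ideal R M I n = ring_colon R M (IpowM (n + k)) (IpowM k)"
    and "rr_module R M I n = module_colon M (IpowM (n + k)) (Ipow k)"
proof -
  have "1 \<le> k" and *: "rr_module R M I (n + k) = IpowM (n + k)"
    using rr_index_props[OF assms(1-3)] k by auto
  then have "ring_colon R M (IpowM (n + k)) (IpowM k) \<subseteq> rr_ideal R M I n"
    and "module_colon M (IpowM (n + k)) (Ipow k) \<subseteq> rr_module R M I n"
    unfolding rr_ideal_def rr_module_def by auto
  then show "rr_ideal R M I n = ring_colon R M (IpowM (n + k)) (IpowM k)"
    and "rr_module R M I n = module_colon M (IpowM (n + k)) (Ipow k)"
    using rr_ideal_subset_colon[OF *] rr_module_subset_colon[OF *] by blast+
qed

end

section \<open>The ring as a module over itself\<close>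

context cring
begin

text \<open>
  This identifies \<open>I\<^sup>nR\<close> with \<open>I\<^sup>n\<close>, so that for \<open>M = R\<close> the closure of \<open>I\<^sup>n\<close> is the ideal
  \<open>r(I\<^sup>n, R)\<close> and the last assertion becomes a case of the first one.
\<close>
lemma ideal_smult_ring_module:
  assumes L: "ideal L R"
  shows "ideal_smult R (ring_module R) L = L"
proof
  interpret RM: module R "ring_module R"
    by (rule ring_module_is_module)
  interpret L: ideal L R
    by fact
  have "submodule L R (ring_module R)"
    by (rule RM.submoduleI') (auto intro: L.I_l_closed L.Icarr)
  then show "ideal_smult R (ring_module R) L \<subseteq> L"
    unfolding ideal_smult_def by (rule RM.gen_submodule_minimal) (auto intro: L.I_r_closed)
  show "L \<subseteq> ideal_smult R (ring_module R) L"
  proof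
    fix a assume a: "a \<in> L"
    then have "a = a \<otimes> \<one>"
      using L.Icarr by simp
    then have "a \<in> {a \<otimes> x | a x. a \<in> L \<and> x \<in> carrier R}"
      using a by blast
    then show "a \<in> ideal_smult R (ring_module R) L"
      unfolding ideal_smult_def using RM.gen_submodule_superset by fastforce
  qed
qed

lemma fin_gen_ring_module: "fin_gen_module R (ring_module R)"
proof -
  interpret RM: module R "ring_module R"
    by (rule ring_module_is_module)
  let ?G = "gen_submodule R (ring_module R) {\<one>}"
  have sub: "submodule ?G R (ring_module R)"
    by (rule RM.submodule_gen_submodule) simp
  have one: "\<one> \<in> ?G"
    using RM.gen_submodule_superset[of "{\<one>}"] by simp
  have "a \<in> ?G" if "a \<in> carrier R" for a
    using RM.submoduleE(4)[OF sub that one] that by simp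
  then have "carrier (ring_module R) = ?G"
    using RM.submoduleE(1)[OF sub] by auto
  then show ?thesis
    unfolding fin_gen_module_def using RM.module_axioms
    by (intro conjI exI[of _ "{\<one>}"]) auto
qed

end

theorem theorem8p12:
  fixes R :: "('a, 'c) ring_scheme"
    and \<mm> I :: "'a set"
    and M :: "('a, 'b, 'd) module_scheme"
  assumes "noetherian_local_ring R \<mm>"
    and "ideal I R"
  shows "(fin_gen_module R M \<and> grade_pos R M I \<longrightarrow>
           (\<forall>k \<ge> rr_index R M I.
              (\<forall>n \<ge> 1. rr_ideal R M I n =
                 ring_colon R M (power_smult R M I (n + k)) (power_smult R M I k)) \<and>
              (\<forall>n \<ge> 1. rr_module R M I n =
                 module_colon M (power_smult R M I (n + k)) (ideal_power R I k))))
       \<and> (grade_pos R (ring_module R) I \<longrightarrow>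
           (\<forall>n \<ge> 1. \<forall>k \<ge> rr_index R (ring_module R) I.
              rr_closure R I n =
                ring_colon R (ring_module R) (ideal_power R I (n + k)) (ideal_power R I k)))"
proof (intro conjI impI)
  interpret noetherian_local_ring R \<mm>
    by fact
  have noeth: "noetherian_ring R" ..
  show "\<forall>k \<ge> rr_index R M I.
      (\<forall>n \<ge> 1. rr_ideal R M I n =
         ring_colon R M (power_smult R M I (n + k)) (power_smult R M I k)) \<and>
      (\<forall>n \<ge> 1. rr_module R M I n =
         module_colon M (power_smult R M I (n + k)) (ideal_power R I k))"
    if fg: "fin_gen_module R M \<and> grade_pos R M I"
  proof -
    interpret module_with_ideal R M I
      using fg assms(2)
      by (simp add: module_with_ideal_def module_with_ideal_axioms_def fin_gen_module_def)
    show ?thesis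
      using rr_eq_colon[OF noeth] fg by blast
  qed
  show "\<forall>n \<ge> 1. \<forall>k \<ge> rr_index R (ring_module R) I.
      rr_closure R I n =
        ring_colon R (ring_module R) (ideal_power R I (n + k)) (ideal_power R I k)"
    if gr: "grade_pos R (ring_module R) I"
  proof -
    interpret RM: module_with_ideal R "ring_module R" I
      using assms(2) ring_module_is_module
      by (simp add: module_with_ideal_def module_with_ideal_axioms_def)
    have pow: "power_smult R (ring_module R) I n = ideal_power R I n" for n
      by (rule ideal_smult_ring_module[OF ideal_ideal_power[OF assms(2)]])
    have "rr_closure R I n = rr_ideal R (ring_module R) I n" for n
      by (simp add: rr_closure_def rr_ideal_def pow)
    then show ?thesis
      using RM.rr_eq_colon(1)[OF noeth fin_gen_ring_module gr] by (simp add: pow)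
  qed
qed

end
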